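(* Let $(\mathbf{x}^k)_{k\ge 1}$ be the sequence generated by Adam (as defined in the context). Assume: (i) $\mathbb{E}[\mathbf{g}^k\mid\mathcal{F}^k]=\nabla f(\mathbf{x}^k)$ for all $k\ge1$, and there exists $M>0$ such that $\|\mathbf{g}^k\|\le M$ almost surely for all $k\ge1$; (ii) $f$ is bounded below, with $f^*:=\inf_{\mathbf{x}\in\mathbb{R}^d} f(\mathbf{x})>-\infty$, and $f$ is $L$-smooth for some $L>0$, i.e. $\|\nabla f(\mathbf{x})-\nabla f(\mathbf{y})\|\le L\|\mathbf{x}-\mathbf{y}\|$ for all $\mathbf{x},\mathbf{y}\in\mathbb{R}^d$; (iii) for all $k\ge1$, $\eta_k=1/k^{q}$ with $1/2<q<1$, and $\theta_k=1-1/k^{p}$ with $p>1-q$. Then, almost surely, as $K\to\infty$, $$\min_{1\le k\le K}\|\nabla f(\mathbf{x}^k)\|^2=o\left(\frac{1}{K^{1-q}}\right).$$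
   Context: Setting: $f:\mathbb{R}^d\to\mathbb{R}$ is differentiable, $f(\mathbf{x})=\mathbb{E}_{\xi\sim\mathbb{P}}[\ell(\mathbf{x};\xi)]$. All vector operations (powers, square roots, products, quotients, adding a scalar) are element-wise; $\|\cdot\|$ is the Euclidean norm. Adam: given deterministic parameters $\eta_k>0$ (step size), $\epsilon>0$, $0\le\beta_k\le\beta<1$, $\theta_k\in[0,1)$ for $k\ge1$, initialize $\mathbf{m}^0=\mathbf{0}$, $\mathbf{v}^0=\mathbf{0}$, $\mathbf{x}^1\in\mathbb{R}^d$ (deterministic). For $k=1,2,\dots$: sample the stochastic gradient $\mathbf{g}^k=\nabla\ell(\mathbf{x}^k;\xi^k)$, where $\xi^k$ is the random data sample drawn at iteration $k$, and set $$\mathbf{m}^k=\beta_k\mathbf{m}^{k-1}+(1-\beta_k)\mathbf{g}^k,\quad \mathbf{v}^k=\theta_k\mathbf{v}^{k-1}+(1-\theta_k)(\mathbf{g}^k)^2,\quad \mathbf{x}^{k+1}=\mathbf{x}^k-\eta_k\frac{\mathbf{m}^k}{\sqrt{\mathbf{v}^k+\epsilon}}.$$ $\mathcal{F}^k:=\sigma(\mathbf{x}^1,\dots,\mathbf{x}^k)$. *)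

theory Defs
  imports "HOL-Probability.Probability" "HOL-Library.Landau_Symbols"
begin

text \<open>Meaningful only where \<open>f\<close> is differentiable; \<open>GDERIV\<close> is the library's relational gradient.\<close>

definition grad :: "('b::real_inner \<Rightarrow> real) \<Rightarrow> 'b \<Rightarrow> 'b"
  where "grad f x = (THE D. GDERIV f x :> D)"

text \<open>The library only has conditional expectations of real functions, so the vector-valued one is
  taken coordinatewise.\<close>

definition vec_cond_exp ::
    "'a measure \<Rightarrow> 'a measure \<Rightarrow> ('a \<Rightarrow> real ^ 'n) \<Rightarrow> 'a \<Rightarrow> real ^ 'n"
  where "vec_cond_exp M F X = (\<lambda>\<omega>. \<chi> i. real_cond_exp M F (\<lambda>\<omega>'. X \<omega>' $ i) \<omega>)"

definition history :: "'a measure \<Rightarrow> (nat \<Rightarrow> 'a \<Rightarrow> 'b::topological_space) \<Rightarrow> nat \<Rightarrow> 'a measure"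
  where "history M x k =
    sigma (space M) (\<Union>j\<in>{1..k}. {x j -` A \<inter> space M | A. A \<in> sets borel})"

definition adam_parameters ::
    "(nat \<Rightarrow> real) \<Rightarrow> real \<Rightarrow> (nat \<Rightarrow> real) \<Rightarrow> real \<Rightarrow> (nat \<Rightarrow> real) \<Rightarrow> bool"
  where "adam_parameters \<eta> \<epsilon> \<beta> \<beta>max \<theta> \<longleftrightarrow>
    \<epsilon> > 0 \<and> \<beta>max < 1 \<and>
    (\<forall>k\<ge>1. \<eta> k > 0 \<and> 0 \<le> \<beta> k \<and> \<beta> k \<le> \<beta>max \<and> 0 \<le> \<theta> k \<and> \<theta> k < 1)"

text \<open>\<open>M\<close> is the probability space carrying the run and \<open>P\<close> the data distribution. Each sample \<open>\<xi> k\<close>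
  has law \<open>P\<close>; no independence between samples is required. The gradients \<open>g k\<close> are required to be
  random vectors because the loss is not assumed jointly measurable. The iterates \<open>x\<close> and the
  samples \<open>\<xi>\<close> are indexed from 1 (\<open>x 0\<close>, \<open>g 0\<close> and \<open>\<xi> 0\<close> are irrelevant).\<close>

definition adam_run ::
    "'a measure \<Rightarrow> 's measure \<Rightarrow> (real ^ 'n \<Rightarrow> 's \<Rightarrow> real) \<Rightarrow>
     (nat \<Rightarrow> real) \<Rightarrow> real \<Rightarrow> (nat \<Rightarrow> real) \<Rightarrow> (nat \<Rightarrow> real) \<Rightarrow> real ^ 'n \<Rightarrow>
     (nat \<Rightarrow> 'a \<Rightarrow> 's) \<Rightarrow> (nat \<Rightarrow> 'a \<Rightarrow> real ^ 'n) \<Rightarrow> (nat \<Rightarrow> 'a \<Rightarrow> real ^ 'n) \<Rightarrow>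
     (nat \<Rightarrow> 'a \<Rightarrow> real ^ 'n) \<Rightarrow> (nat \<Rightarrow> 'a \<Rightarrow> real ^ 'n) \<Rightarrow> bool"
  where "adam_run M P \<l> \<eta> \<epsilon> \<beta> \<theta> x1 \<xi> g m v x \<longleftrightarrow>
    (\<forall>k\<ge>1. \<xi> k \<in> measurable M P \<and> distr M P (\<xi> k) = P \<and> g k \<in> borel_measurable M) \<and>
    (\<forall>\<omega>\<in>space M.
       m 0 \<omega> = 0 \<and> v 0 \<omega> = 0 \<and> x 1 \<omega> = x1 \<and>
       (\<forall>k\<ge>1.
          (\<lambda>y. \<l> y (\<xi> k \<omega>)) differentiable (at (x k \<omega>)) \<and>
          g k \<omega> = grad (\<lambda>y. \<l> y (\<xi> k \<omega>)) (x k \<omega>) \<and>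
          (\<forall>i. m k \<omega> $ i = \<beta> k * m (k - 1) \<omega> $ i + (1 - \<beta> k) * g k \<omega> $ i) \<and>
          (\<forall>i. v k \<omega> $ i = \<theta> k * v (k - 1) \<omega> $ i + (1 - \<theta> k) * (g k \<omega> $ i)\<^sup>2) \<and>
          (\<forall>i. x (k + 1) \<omega> $ i = x k \<omega> $ i - \<eta> k * (m k \<omega> $ i / sqrt (v k \<omega> $ i + \<epsilon>)))))"

end

theory Submission
  imports Defs
begin

text \<open>Write \<open>h k = m k / sqrt (v k + \<epsilon>)\<close> for the normalized step. Smoothness bounds
  \<open>\<Sum>k. \<eta> k * E[grad f (x k) \<bullet> h k]\<close> from above, so it suffices to bound each summand from below by a multiple
  of \<open>E[(norm (grad f (x k)))\<^sup>2]\<close>, up to a momentum term and an error whose weighted sum is finite: then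
  \<open>\<Sum>k. \<eta> k * (norm (grad f (x k)))\<^sup>2\<close> is almost surely finite, and the rate follows from
  \<open>\<eta> k = 1 / k powr q\<close>.

  The usual argument for the lower bound replaces \<open>sqrt (v k + \<epsilon>)\<close> by \<open>sqrt (v (k - 1) + \<epsilon>)\<close> and then
  conditions on the past, but \<open>v (k - 1)\<close> need not be a function of \<open>x 1, \<dots>, x k\<close>: a coordinate of the step
  determines the corresponding coordinate of \<open>g k\<close> only up to the choice between two roots of a
  quadratic. The choice is forced once \<open>1 - \<theta> k\<close> is small, so each coordinate hides only
  finitely many alternatives. Their posterior probabilities are bounded martingales, whose increments
  are square summable in \<open>L\<^sup>2\<close>; as \<open>\<Sum>k. (\<eta> k)\<^sup>2\<close> is finite, replacing the hidden scale by its posterior mean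
  costs only a finite amount in total.\<close>

section \<open>Weighted sums\<close>

text \<open>The upper half of \<open>{1..K}\<close> has at least \<open>K / 2\<close> terms, each no
  smaller than the minimum divided by \<open>K powr q\<close>, and by the Cauchy criterion their sum
  is eventually as small as desired. Clearing denominators leaves the factor
  \<open>K powr (1 - q)\<close>.\<close>

lemma Min_smallo_of_weighted_summable:
  fixes u :: "nat \<Rightarrow> real"
  assumes q: "0 \<le> q" and u: "\<And>k. u k \<ge> 0"
    and s: "summable (\<lambda>k. u k / real k powr q)"
  shows "(\<lambda>K. MIN k\<in>{1..K}. u k) \<in> o(\<lambda>K. 1 / real K powr (1 - q))"
proof (rule landau_o.smallI)
  fix c :: real assume c: "c > 0"
  obtain N where N: "\<And>m n. m \<ge> N \<Longrightarrow> norm (\<Sum>k=m..<n. u k / real k powr q) < c / 2"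
    using s c unfolding summable_Cauchy by (metis half_gt_zero)
  show "\<forall>\<^sub>F K in sequentially. norm (MIN k\<in>{1..K}. u k) \<le> c * norm (1 / real K powr (1 - q))"
  proof (rule eventually_sequentiallyI)
    \<comment> \<open>This threshold puts the block \<open>{K div 2 + 1..<K + 1}\<close> beyond
      \<open>N\<close> and keeps the set under the minimum nonempty.\<close>
    fix K assume K: "2 * N + 2 \<le> K"
    define \<mu> where "\<mu> = (MIN k\<in>{1..K}. u k)"
    have Kp: "real K > 0" using K by simp
    have \<mu>le: "\<mu> \<le> u k" if "k \<in> {1..K}" for k
      unfolding \<mu>_def using that by (intro Min_le) auto
    have \<mu>0: "\<mu> \<ge> 0"
      unfolding \<mu>_def using K u by (subst Min_ge_iff) auto
    have "real K / 2 * (\<mu> / real K powr q) \<le> real (card {K div 2 + 1..<K + 1}) * (\<mu> / real K powr q)"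
      using \<mu>0 by (intro mult_right_mono) auto
    also have "\<dots> = (\<Sum>k=K div 2 + 1..<K + 1. \<mu> / real K powr q)" by simp
    also have "\<dots> \<le> (\<Sum>k=K div 2 + 1..<K + 1. u k / real k powr q)"
    proof (intro sum_mono frac_le)
      fix k assume k: "k \<in> {K div 2 + 1..<K + 1}"
      then show "\<mu> \<le> u k" "u k \<ge> 0" using u by (auto intro!: \<mu>le)
      show "real k powr q > 0" "real k powr q \<le> real K powr q"
        using k q by (auto intro!: powr_mono2)
    qed
    also have "\<dots> \<le> c / 2"
    proof -
      have "N \<le> K div 2 + 1" using K by linarith
      from N[OF this, of "K + 1"] show ?thesis unfolding real_norm_def by linarith
    qed
    finally have "real K * \<mu> \<le> c * real K powr q"
      using Kp by (simp add: field_simps)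
    then have "\<mu> \<le> c * (1 / real K powr (1 - q))"
      using Kp by (simp add: powr_diff field_simps)
    then show "norm (MIN k\<in>{1..K}. u k) \<le> c * norm (1 / real K powr (1 - q))"
      using \<mu>0 by (simp add: \<mu>_def)
  qed
qed

text \<open>The negative part \<open>max 0 (- a k)\<close> contracts with factor \<open>\<beta>max\<close> up to the error \<open>e k\<close>, so its
  weighted sum is finite; this controls the momentum terms \<open>\<beta> k * a (k - 1)\<close> of either sign.\<close>

lemma momentum_sum_bound:
  fixes a b e \<eta> \<beta> :: "nat \<Rightarrow> real"
  assumes rec: "\<And>k. k \<ge> 1 \<Longrightarrow> a k \<ge> \<beta> k * a (k - 1) + c * b k - e k"
    and a0: "a 0 = 0" and c: "c > 0"
    and \<beta>: "\<And>k. k \<ge> 1 \<Longrightarrow> 0 \<le> \<beta> k" "\<And>k. k \<ge> 1 \<Longrightarrow> \<beta> k \<le> \<beta>max" and \<beta>max: "\<beta>max < 1"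
    and \<eta>: "\<And>k. k \<ge> 1 \<Longrightarrow> \<eta> k > 0" "\<And>k. k \<ge> 1 \<Longrightarrow> \<eta> (Suc k) \<le> \<eta> k"
    and b: "\<And>k. k \<ge> 1 \<Longrightarrow> b k \<ge> 0" and e: "\<And>k. k \<ge> 1 \<Longrightarrow> e k \<ge> 0"
    and e_sum: "\<And>K. (\<Sum>k=1..K. \<eta> k * e k) \<le> E"
    and a_sum: "\<And>K. (\<Sum>k=1..K. \<eta> k * a k) \<le> A"
  shows "\<exists>B. \<forall>K. (\<Sum>k=1..K. \<eta> k * b k) \<le> B"
proof -
  define N where "N k = max 0 (- a k)" for k
  have N: "N k \<le> \<beta>max * N (k - 1) + e k" "c * b k \<le> a k + N (k - 1) + e k" if "k \<ge> 1" for k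
  proof -
    have 1: "- (\<beta> k * a (k - 1)) \<le> \<beta> k * N (k - 1)"
      using \<beta>(1)[OF that] mult_left_mono[of "- a (k-1)" "N (k-1)" "\<beta> k"] by (simp add: N_def)
    have 2: "\<beta> k * N (k - 1) \<le> \<beta>max * N (k - 1)"
      using \<beta>(2)[OF that] by (intro mult_right_mono) (auto simp: N_def)
    have 3: "\<beta>max * N (k - 1) \<le> 1 * N (k - 1)"
      using \<beta>max by (intro mult_right_mono) (auto simp: N_def)
    have 4: "0 \<le> \<beta> k * N (k - 1)" using \<beta>(1)[OF that] by (auto simp: N_def)
    have "c * b k \<ge> 0" using c b that by simp
    then show "N k \<le> \<beta>max * N (k - 1) + e k" "c * b k \<le> a k + N (k - 1) + e k"
      using rec[OF that] e[OF that] 1 2 3 4 unfolding N_def[of k] by linarith+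
  qed
  have shift: "(\<Sum>k=1..K. \<eta> k * N (k - 1)) \<le> (\<Sum>k=1..K. \<eta> k * N k)" for K
  proof -
    \<comment> \<open>Subtracting the last term makes the claim inductive: the next term
      \<open>\<eta> (Suc K) * N K\<close> fits into the subtracted \<open>\<eta> K * N K\<close>
      because \<eta> decreases. At \<open>K = 0\<close> it vanishes, since
      \<open>a 0 = 0\<close>.\<close>
    have "(\<Sum>k=1..K. \<eta> k * N (k - 1)) \<le> (\<Sum>k=1..K. \<eta> k * N k) - (if K = 0 then 0 else \<eta> K * N K)"
    proof (induction K)
      case (Suc K)
      have "\<eta> (Suc K) * N K \<le> (if K = 0 then 0 else \<eta> K * N K)"
        using \<eta>(2)[of K] a0 by (auto simp: N_def intro!: mult_right_mono)
      then show ?case using Suc by simp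
    qed simp
    also have "\<dots> \<le> (\<Sum>k=1..K. \<eta> k * N k)" using \<eta>(1)[of K] by (auto simp: N_def)
    finally show ?thesis .
  qed
  have b0: "\<beta>max \<ge> 0" using \<beta>[of 1] by simp
  \<comment> \<open>By \<open>shift\<close> the same sum reappears on the right with a factor
    \<open>\<beta>max < 1\<close>, so it is absorbed into the left-hand side.\<close>
  have Nb: "(\<Sum>k=1..K. \<eta> k * N k) \<le> E / (1 - \<beta>max)" for K
  proof -
    have "(\<Sum>k=1..K. \<eta> k * N k) \<le> (\<Sum>k=1..K. \<eta> k * (\<beta>max * N (k - 1) + e k))"
      using N(1) \<eta>(1) by (intro sum_mono mult_left_mono) (auto intro: less_imp_le)
    also have "\<dots> = \<beta>max * (\<Sum>k=1..K. \<eta> k * N (k - 1)) + (\<Sum>k=1..K. \<eta> k * e k)"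
      by (simp add: sum_distrib_left sum.distrib algebra_simps)
    also have "\<dots> \<le> \<beta>max * (\<Sum>k=1..K. \<eta> k * N k) + E"
      using shift b0 e_sum by (intro add_mono mult_left_mono) auto
    finally show ?thesis using \<beta>max by (simp add: field_simps)
  qed
  have "(\<Sum>k=1..K. \<eta> k * b k) \<le> (A + E / (1 - \<beta>max) + E) / c" for K
  proof -
    have "c * (\<Sum>k=1..K. \<eta> k * b k) = (\<Sum>k=1..K. \<eta> k * (c * b k))"
      by (simp add: sum_distrib_left mult_ac)
    also have "\<dots> \<le> (\<Sum>k=1..K. \<eta> k * (a k + N (k - 1) + e k))"
      using N(2) \<eta>(1) by (intro sum_mono mult_left_mono) (auto intro: less_imp_le)
    also have "\<dots> = (\<Sum>k=1..K. \<eta> k * a k) + (\<Sum>k=1..K. \<eta> k * N (k - 1)) + (\<Sum>k=1..K. \<eta> k * e k)"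
      by (simp add: sum.distrib algebra_simps)
    also have "\<dots> \<le> A + E / (1 - \<beta>max) + E"
      using a_sum[of K] e_sum[of K] shift[of K] Nb[of K] by linarith
    finally show ?thesis using c by (simp add: field_simps)
  qed
  then show ?thesis by blast
qed

section \<open>Recovering a gradient from a normalized step\<close>

text \<open>The quadratic formula for \<open>A * g\<^sup>2 + 2 * B * g + C = 0\<close> with
  \<open>A = b\<^sup>2 - y\<^sup>2 * d\<close>, \<open>B = a * b\<close> and
  \<open>C = a\<^sup>2 - y\<^sup>2 * c\<close>, obtained by squaring
  \<open>y * sqrt (c + d * g\<^sup>2) = a + b * g\<close>. The first branch is the degenerate linear
  case. The factor \<open>sgn y\<close> restores the sign lost in squaring, so one bit \<sigma> is
  all that \<open>y\<close> leaves undetermined.\<close>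

definition recover_grad :: "real \<Rightarrow> real \<Rightarrow> real \<Rightarrow> real \<Rightarrow> real \<Rightarrow> real \<Rightarrow> real" where
  "recover_grad a b c d \<sigma> y =
    (if b\<^sup>2 - y\<^sup>2 * d = 0 then - (a\<^sup>2 - y\<^sup>2 * c) / (2 * (a * b))
     else (- (a * b) + \<sigma> * sgn y * sqrt ((a * b)\<^sup>2 - (b\<^sup>2 - y\<^sup>2 * d) * (a\<^sup>2 - y\<^sup>2 * c))) / (b\<^sup>2 - y\<^sup>2 * d))"

text \<open>Squaring the equation for \<open>y\<close> gives \<open>A * g\<^sup>2 + 2 * B * g + C = 0\<close>, and the sign of
  \<open>A * g + B\<close> is that of \<open>y * (b * c - a * d * g)\<close>; this singles out the root.\<close>

lemma recover_grad_eq: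
  fixes a b c d g y :: real
  assumes b: "b > 0" and c: "c > 0" and d: "d > 0"
    and y: "y = (a + b * g) / sqrt (c + d * g\<^sup>2)"
  shows "recover_grad a b c d (if b * c - a * d * g < 0 then - 1 else 1) y = g"
proof -
  define A B C where "A = b\<^sup>2 - y\<^sup>2 * d" and "B = a * b" and "C = a\<^sup>2 - y\<^sup>2 * c"
  define w where "w = c + d * g\<^sup>2"
  have w: "w > 0" using c d by (simp add: w_def add_pos_nonneg)
  have yw: "y\<^sup>2 * w = (a + b * g)\<^sup>2" using w by (simp add: y w_def power_divide)
  have quad: "A * g\<^sup>2 + 2 * B * g + C = 0"
    using yw unfolding A_def B_def C_def w_def by algebra
  \<comment> \<open>Multiplying by \<open>w > 0\<close> preserves the sign and lets
    \<open>y\<^sup>2 * w\<close> be replaced by \<open>(a + b * g)\<^sup>2\<close>, which eliminates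
    \<open>y\<close>.\<close>
  have key: "(A * g + B) * w = (a + b * g) * (b * c - a * d * g)"
  proof -
    have "(A * g + B) * w = b * (a + b * g) * w - (y\<^sup>2 * w) * d * g"
      by (simp add: A_def B_def power2_eq_square algebra_simps)
    also have "\<dots> = (a + b * g) * (b * c - a * d * g)"
      unfolding yw by (simp add: w_def power2_eq_square algebra_simps)
    finally show ?thesis .
  qed
  have sgny: "sgn y = sgn (a + b * g)"
    using w unfolding y w_def[symmetric] by (simp add: sgn_divide)
  have sg: "sgn (A * g + B) = sgn y * sgn (b * c - a * d * g)"
  proof -
    have "sgn (A * g + B) = sgn ((A * g + B) * w)" using w by (simp add: sgn_mult)
    then show ?thesis by (simp add: key sgn_mult sgny)
  qed
  have sq: "sqrt (B\<^sup>2 - A * C) = \<bar>A * g + B\<bar>"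
  proof -
    have "B\<^sup>2 - A * C = (A * g + B)\<^sup>2" using quad by algebra
    then show ?thesis by simp
  qed
  define \<sigma> :: real where "\<sigma> = (if b * c - a * d * g < 0 then - 1 else 1)"
  \<comment> \<open>At a double root, \<open>A * g + B = 0\<close>, both sides vanish whatever
    \<sigma> is. Otherwise \<open>sg\<close> shows that the deciding factor is nonzero, and \<sigma>
    is its sign.\<close>
  have root: "\<sigma> * sgn y * \<bar>A * g + B\<bar> = A * g + B"
  proof (cases "A * g + B = 0")
    case False
    then have "sgn (A * g + B) \<noteq> 0" by (simp only: sgn_zero_iff not_False_eq_True)
    then have nz: "b * c - a * d * g \<noteq> 0" unfolding sg by (metis mult_zero_right sgn_zero)
    then have "\<sigma> = sgn (b * c - a * d * g)" by (auto simp: \<sigma>_def sgn_if)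
    then have "\<sigma> * sgn y = sgn (A * g + B)" using sg by simp
    then show ?thesis by (simp add: mult_sgn_abs)
  qed simp
  show ?thesis
  proof (cases "A = 0")
    case True
    have "y\<^sup>2 * d = b\<^sup>2" using True by (simp add: A_def)
    then have "y \<noteq> 0" using b by auto
    have "B \<noteq> 0"
    proof
      assume "B = 0"
      then have "a = 0" using b by (simp add: B_def)
      then have "C \<noteq> 0" using \<open>y \<noteq> 0\<close> c by (simp add: C_def)
      then show False using quad True \<open>B = 0\<close> by simp
    qed
    then have "- C / (2 * B) = g" using quad True by (simp add: field_simps)
    then show ?thesis using True unfolding recover_grad_def A_def B_def C_def by simp
  next
    case False
    have "(- B + \<sigma> * sgn y * sqrt (B\<^sup>2 - A * C)) / A = g"
      unfolding sq root using False by simp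
    then show ?thesis using False unfolding recover_grad_def A_def B_def C_def \<sigma>_def by simp
  qed
qed

section \<open>Gradients and descent\<close>

text \<open>The representing vector is assembled from the values of the derivative on the basis. As
  \<open>grad\<close> is a definite description, uniqueness of the derivative is what identifies the
  two.\<close>

lemma GDERIV_grad:
  fixes f :: "'b::euclidean_space \<Rightarrow> real"
  assumes "f differentiable (at x)"
  shows "GDERIV f x :> grad f x"
proof -
  obtain f' where f': "(f has_derivative f') (at x)" using assms by (auto simp: differentiable_def)
  interpret linear f' using has_derivative_linear[OF f'] .
  define D where "D = (\<Sum>b\<in>Basis. f' b *\<^sub>R b)"
  have "f' h = inner h D" for h
  proof -
    have "f' h = f' (\<Sum>b\<in>Basis. inner h b *\<^sub>R b)" by (simp only: euclidean_representation)
    also have "\<dots> = inner h D"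
      by (simp add: D_def sum scale inner_sum_right mult.commute)
    finally show ?thesis .
  qed
  then have D: "GDERIV f x :> D" using f' unfolding gderiv_def by presburger
  have uniq: "D' = D" if "GDERIV f x :> D'" for D'
  proof -
    have "(\<lambda>h. inner h D') = (\<lambda>h. inner h D)"
      using that D unfolding gderiv_def by (rule has_derivative_unique)
    then have "\<forall>h. inner h D' = inner h D" by (rule fun_cong[THEN allI])
    then show ?thesis by (simp only: vector_eq_ldot)
  qed
  show ?thesis unfolding grad_def by (rule theI[of _ D]) (fact D, fact uniq)
qed

text \<open>The mean value theorem on the segment compares gradients at a single intermediate point,
  which gives the constant \<open>L\<close> instead of the sharp \<open>L / 2\<close>; for
  summability the constant is immaterial.\<close>

lemma descent_ineq:
  fixes f :: "'b::euclidean_space \<Rightarrow> real"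
  assumes diff: "\<And>y. f differentiable (at y)"
    and L: "\<And>y z. norm (grad f y - grad f z) \<le> L * norm (y - z)"
  shows "f y \<le> f x + inner (y - x) (grad f x) + L * (norm (y - x))\<^sup>2"
proof -
  define \<phi> where "\<phi> t = f (x + t *\<^sub>R (y - x))" for t :: real
  have der: "(\<phi> has_derivative (\<lambda>h. h * inner (y - x) (grad f (x + t *\<^sub>R (y - x))))) (at t)" for t
  proof -
    have "((\<lambda>t. x + t *\<^sub>R (y - x)) has_derivative (\<lambda>h. h *\<^sub>R (y - x))) (at t)"
      by (auto intro!: derivative_eq_intros)
    from has_derivative_compose[OF this GDERIV_grad[OF diff, unfolded gderiv_def]]
    show ?thesis unfolding \<phi>_def by simp
  qed
  have "\<exists>t\<in>{0<..<1}. \<phi> 1 - \<phi> 0 = (1 - 0) * inner (y - x) (grad f (x + t *\<^sub>R (y - x)))"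
    by (rule mvt_simple) (auto intro!: has_derivative_at_withinI der)
  then obtain t where t: "0 < t" "t < 1"
    and eq: "f y - f x = inner (y - x) (grad f (x + t *\<^sub>R (y - x)))"
    by (auto simp: \<phi>_def)
  \<comment> \<open>Nonnegativity of \<open>L\<close> is read off from the Lipschitz bound at two
    distinct points.\<close>
  have L0: "L \<ge> 0 \<or> y = x"
    using order_trans[OF norm_ge_zero L[of y x]] by (auto simp: zero_le_mult_iff)
  have "f y - f x - inner (y - x) (grad f x) = inner (y - x) (grad f (x + t *\<^sub>R (y - x)) - grad f x)"
    by (simp add: eq inner_diff_right)
  also have "\<dots> \<le> norm (y - x) * norm (grad f (x + t *\<^sub>R (y - x)) - grad f x)"
    by (rule norm_cauchy_schwarz)
  also have "\<dots> \<le> norm (y - x) * (L * norm (t *\<^sub>R (y - x)))"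
    using L[of "x + t *\<^sub>R (y - x)" x] by (intro mult_left_mono) auto
  also have "\<dots> \<le> norm (y - x) * (L * norm (y - x))"
  proof (cases "y = x")
    case False
    then show ?thesis using L0 t by (auto intro!: mult_left_mono mult_left_le_one_le)
  qed simp
  finally show ?thesis by (simp add: power2_eq_square algebra_simps)
qed

section \<open>Scales hidden from the filtration\<close>

lemma (in prob_space) sigma_finite_subalgebra_prob:
  "subalgebra M F \<Longrightarrow> sigma_finite_subalgebra M F"
  by (intro finite_measure_subalgebra_is_sigma_finite)
     (simp add: finite_measure_subalgebra_def finite_measure_subalgebra_axioms_def finite_measure_axioms)

lemma (in prob_space) integrable_indicator_event:
  "A \<in> events \<Longrightarrow> integrable M (indicator A :: 'a \<Rightarrow> real)"
  by (intro integrable_real_indicator) (auto simp: less_top[symmetric])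

lemma (in prob_space) real_cond_exp_abs_le:
  assumes F: "subalgebra M F" and g: "g \<in> borel_measurable M" and B: "AE \<omega> in M. \<bar>g \<omega>\<bar> \<le> B"
  shows "AE \<omega> in M. \<bar>real_cond_exp M F g \<omega>\<bar> \<le> B"
proof -
  interpret sigma_finite_subalgebra M F by (rule sigma_finite_subalgebra_prob[OF F])
  have int: "integrable M g" using g B by (intro integrable_const_bound[of _ B]) auto
  have "AE \<omega> in M. real_cond_exp M F g \<omega> \<ge> - B" "AE \<omega> in M. real_cond_exp M F g \<omega> \<le> B"
    using int B by (intro real_cond_exp_ge_c real_cond_exp_le_c; force)+
  then show ?thesis by eventually_elim auto
qed

lemma (in prob_space) real_cond_exp_indicator_bounds:
  assumes F: "subalgebra M F" and A: "A \<in> events"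
  shows "AE \<omega> in M. 0 \<le> real_cond_exp M F (indicator A) \<omega> \<and> real_cond_exp M F (indicator A) \<omega> \<le> 1"
proof -
  interpret sigma_finite_subalgebra M F by (rule sigma_finite_subalgebra_prob[OF F])
  have int: "integrable M (indicator A :: 'a \<Rightarrow> real)" by (rule integrable_indicator_event[OF A])
  have "AE \<omega> in M. real_cond_exp M F (indicator A) \<omega> \<ge> 0"
    "AE \<omega> in M. real_cond_exp M F (indicator A) \<omega> \<le> 1"
    using int by (intro real_cond_exp_ge_c real_cond_exp_le_c; simp)+
  then show ?thesis by eventually_elim auto
qed

text \<open>Increments of a martingale are orthogonal, so their second moments telescope, and for
  values in the unit interval they sum to at most 1. The inequality
  \<open>2 * s * t \<le> s\<^sup>2 + t\<^sup>2\<close> converts this into a bound on the weighted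
  first moments.\<close>

lemma (in prob_space) sum_posterior_increments_le:
  fixes \<eta> :: "nat \<Rightarrow> real"
  assumes F: "\<And>k. subalgebra M (F k)" "\<And>k. subalgebra (F (Suc k)) (F k)" and A: "A \<in> events"
  defines "\<pi> \<equiv> \<lambda>k. real_cond_exp M (F k) (indicator A)"
  shows "(\<Sum>k=1..n. \<eta> k * (\<integral>\<omega>. \<bar>\<pi> (Suc k) \<omega> - \<pi> k \<omega>\<bar> \<partial>M)) \<le> ((\<Sum>k=1..n. (\<eta> k)\<^sup>2) + 1) / 2"
proof -
  have \<pi>_F[measurable]: "\<pi> k \<in> borel_measurable (F k)" for k unfolding \<pi>_def by simp
  have \<pi>_F': "\<pi> k \<in> borel_measurable (F (Suc k))" for k
    using measurable_from_subalg[OF F(2) \<pi>_F] .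
  have [measurable]: "\<pi> k \<in> borel_measurable M" for k unfolding \<pi>_def by simp
  have [measurable]: "(indicator A :: 'a \<Rightarrow> real) \<in> borel_measurable M" using A by simp
  have bnd: "AE \<omega> in M. 0 \<le> \<pi> k \<omega> \<and> \<pi> k \<omega> \<le> 1" for k
    unfolding \<pi>_def by (rule real_cond_exp_indicator_bounds[OF F(1) A])
  have int1: "integrable M (\<lambda>\<omega>. \<pi> k \<omega> * \<pi> j \<omega>)" for k j
  proof (rule integrable_const_bound[of _ 1])
    show "AE \<omega> in M. norm (\<pi> k \<omega> * \<pi> j \<omega>) \<le> 1"
      using bnd[of k] bnd[of j] by eventually_elim (auto simp: abs_mult intro!: mult_le_one)
  qed simp
  have int2: "integrable M (\<lambda>\<omega>. \<pi> k \<omega> * indicator A \<omega>)" for k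
  proof (rule integrable_const_bound[of _ 1])
    show "AE \<omega> in M. norm (\<pi> k \<omega> * indicator A \<omega>) \<le> 1"
      using bnd[of k] by eventually_elim (auto simp: indicator_def)
  qed simp
  \<comment> \<open>Against an \<open>F j\<close>-measurable factor the posterior at time
    \<open>j\<close> may be exchanged for the indicator. Used for \<open>j = k\<close> and
    \<open>j = Suc k\<close>, this gives \<open>\<pi> k * \<pi> (Suc k)\<close> the same expectation
    as \<open>\<pi> k * \<pi> k\<close>.\<close>
  have proj: "(\<integral>\<omega>. \<pi> k \<omega> * \<pi> j \<omega> \<partial>M) = (\<integral>\<omega>. \<pi> k \<omega> * indicator A \<omega> \<partial>M)"
    if "\<pi> k \<in> borel_measurable (F j)" for k j
  proof -
    interpret sigma_finite_subalgebra M "F j" by (rule sigma_finite_subalgebra_prob[OF F(1)])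
    show ?thesis using real_cond_exp_intg(2)[OF int2 that] unfolding \<pi>_def by simp
  qed
  define D where "D k = (\<integral>\<omega>. (\<pi> (Suc k) \<omega> - \<pi> k \<omega>)\<^sup>2 \<partial>M)" for k
  define s where "s k = (\<integral>\<omega>. \<pi> k \<omega> * \<pi> k \<omega> \<partial>M)" for k
  have intD: "integrable M (\<lambda>\<omega>. (\<pi> (Suc k) \<omega> - \<pi> k \<omega>)\<^sup>2)" for k
    using int1 by (simp add: power2_eq_square algebra_simps)
  have "D k = s (Suc k) - s k" for k
  proof -
    have "D k = (\<integral>\<omega>. \<pi> (Suc k) \<omega> * \<pi> (Suc k) \<omega> + \<pi> k \<omega> * \<pi> k \<omega> - 2 * (\<pi> k \<omega> * \<pi> (Suc k) \<omega>) \<partial>M)"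
      unfolding D_def by (intro Bochner_Integration.integral_cong) (auto simp: power2_eq_square algebra_simps)
    also have "\<dots> = s (Suc k) + s k - 2 * (\<integral>\<omega>. \<pi> k \<omega> * \<pi> (Suc k) \<omega> \<partial>M)"
      using int1 unfolding s_def by simp
    also have "(\<integral>\<omega>. \<pi> k \<omega> * \<pi> (Suc k) \<omega> \<partial>M) = s k"
      unfolding s_def proj[OF \<pi>_F'] proj[OF \<pi>_F] ..
    finally show ?thesis by simp
  qed
  then have "(\<Sum>k=1..n. D k) = s (Suc n) - s 1"
    by (simp add: sum_Suc_diff)
  moreover have "s (Suc n) \<le> 1"
  proof -
    have "s (Suc n) \<le> (\<integral>\<omega>. 1 \<partial>M)"
      unfolding s_def
    proof (intro integral_mono_AE int1)
      show "AE \<omega> in M. \<pi> (Suc n) \<omega> * \<pi> (Suc n) \<omega> \<le> 1"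
        using bnd[of "Suc n"] by eventually_elim (auto intro!: mult_le_one)
    qed simp
    then show ?thesis by (simp add: prob_space)
  qed
  moreover have "s 1 \<ge> 0" unfolding s_def by (intro integral_nonneg_AE) auto
  ultimately have D1: "(\<Sum>k=1..n. D k) \<le> 1" by linarith
  have "\<eta> k * (\<integral>\<omega>. \<bar>\<pi> (Suc k) \<omega> - \<pi> k \<omega>\<bar> \<partial>M) \<le> ((\<eta> k)\<^sup>2 + D k) / 2" for k
  proof -
    have i: "integrable M (\<lambda>\<omega>. \<bar>\<pi> (Suc k) \<omega> - \<pi> k \<omega>\<bar>)"
      unfolding \<pi>_def using A F(1)
      by (intro integrable_abs Bochner_Integration.integrable_diff
          sigma_finite_subalgebra.real_cond_exp_int sigma_finite_subalgebra_prob integrable_indicator_event) auto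
    have "\<eta> k * (\<integral>\<omega>. \<bar>\<pi> (Suc k) \<omega> - \<pi> k \<omega>\<bar> \<partial>M) = (\<integral>\<omega>. \<eta> k * \<bar>\<pi> (Suc k) \<omega> - \<pi> k \<omega>\<bar> \<partial>M)" by simp
    also have "\<dots> \<le> (\<integral>\<omega>. ((\<eta> k)\<^sup>2 + (\<pi> (Suc k) \<omega> - \<pi> k \<omega>)\<^sup>2) / 2 \<partial>M)"
    proof (intro integral_mono)
      fix \<omega>
      show "\<eta> k * \<bar>\<pi> (Suc k) \<omega> - \<pi> k \<omega>\<bar> \<le> ((\<eta> k)\<^sup>2 + (\<pi> (Suc k) \<omega> - \<pi> k \<omega>)\<^sup>2) / 2"
        using sum_squares_bound[of "\<eta> k" "\<bar>\<pi> (Suc k) \<omega> - \<pi> k \<omega>\<bar>"] by (simp add: power2_eq_square)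
    qed (use i intD in simp_all)
    also have "\<dots> = ((\<eta> k)\<^sup>2 + D k) / 2"
      using intD by (simp add: D_def prob_space)
    finally show ?thesis .
  qed
  then have "(\<Sum>k=1..n. \<eta> k * (\<integral>\<omega>. \<bar>\<pi> (Suc k) \<omega> - \<pi> k \<omega>\<bar> \<partial>M)) \<le> (\<Sum>k=1..n. ((\<eta> k)\<^sup>2 + D k) / 2)"
    by (rule sum_mono)
  also have "\<dots> = ((\<Sum>k=1..n. (\<eta> k)\<^sup>2) + (\<Sum>k=1..n. D k)) / 2"
    by (simp add: sum_divide_distrib[symmetric] sum.distrib)
  finally show ?thesis using D1 by simp
qed

text \<open>The scale \<open>W\<close> need not be \<open>F\<close>-measurable: it is \<open>Y i\<close> on the hidden event \<open>A i\<close>. Testing with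
  \<open>\<phi>\<close> divided by the posterior mean of \<open>W\<close> (the \<open>Wh\<close> of the proof) makes it disappear, up to the
  revision of the posterior caused by observing \<open>h\<close>.\<close>

lemma (in prob_space) hidden_scale_step:
  fixes Y :: "'b \<Rightarrow> 'a \<Rightarrow> real" and W W' h h0 g \<phi> :: "'a \<Rightarrow> real"
  assumes F: "subalgebra M F" and F': "subalgebra M F'" and FF': "subalgebra F' F"
    and A: "\<And>i. i \<in> I \<Longrightarrow> A i \<in> events"
    and part: "\<And>\<omega>. \<omega> \<in> space M \<Longrightarrow> (\<Sum>i\<in>I. indicator (A i) \<omega> :: real) = 1"
    and Y: "\<And>i. i \<in> I \<Longrightarrow> Y i \<in> borel_measurable F"
    and Yb: "\<And>i \<omega>. i \<in> I \<Longrightarrow> c \<le> Y i \<omega> \<and> Y i \<omega> \<le> C" and c: "0 < c" "c \<le> C"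
    and W: "W \<in> borel_measurable M" "AE \<omega> in M. W \<omega> = (\<Sum>i\<in>I. Y i \<omega> * indicator (A i) \<omega>)"
    and W': "W' \<in> borel_measurable M" "AE \<omega> in M. \<bar>W' \<omega> - W \<omega>\<bar> \<le> \<delta>"
    and h: "h \<in> borel_measurable F'" "AE \<omega> in M. \<bar>h \<omega>\<bar> \<le> H"
    and h0: "h0 \<in> borel_measurable F" "AE \<omega> in M. \<bar>h0 \<omega>\<bar> \<le> H"
    and g: "g \<in> borel_measurable M" "AE \<omega> in M. \<bar>g \<omega>\<bar> \<le> G"
    and \<phi>: "\<phi> \<in> borel_measurable F" "AE \<omega> in M. real_cond_exp M F g \<omega> = \<phi> \<omega>"
    and \<beta>: "0 \<le> \<beta>" "\<beta> < 1"
    and rec: "AE \<omega> in M. W' \<omega> * h \<omega> = \<beta> * (W \<omega> * h0 \<omega>) + (1 - \<beta>) * g \<omega>"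
  defines "R \<equiv> (\<Sum>i\<in>I. \<integral>\<omega>. \<bar>real_cond_exp M F' (indicator (A i)) \<omega> - real_cond_exp M F (indicator (A i)) \<omega>\<bar> \<partial>M)"
  shows "\<beta> * (\<integral>\<omega>. \<phi> \<omega> * h0 \<omega> \<partial>M) + (1 - \<beta>) / C * (\<integral>\<omega>. (\<phi> \<omega>)\<^sup>2 \<partial>M) - G / c * H * (\<delta> + C * R)
    \<le> (\<integral>\<omega>. \<phi> \<omega> * h \<omega> \<partial>M)"
proof -
  define \<pi> where "\<pi> i = real_cond_exp M F (indicator (A i))" for i
  define \<pi>' where "\<pi>' i = real_cond_exp M F' (indicator (A i))" for i
  define Wh where "Wh \<omega> = (\<Sum>i\<in>I. \<pi> i \<omega> * Y i \<omega>)" for \<omega>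
  define \<psi> where "\<psi> \<omega> = \<phi> \<omega> / Wh \<omega>" for \<omega>
  note [measurable] = W(1) W'(1) g(1)
  have fromF: "f \<in> borel_measurable M" "f \<in> borel_measurable F'" if "f \<in> borel_measurable F" for f :: "'a \<Rightarrow> real"
    using measurable_from_subalg[OF F that] measurable_from_subalg[OF FF' that] by auto
  note [measurable] = measurable_from_subalg[OF F' h(1)] fromF[OF h0(1)] fromF[OF \<phi>(1)]
  have \<pi>m: "\<pi> i \<in> borel_measurable F" for i unfolding \<pi>_def by simp
  note [measurable] = fromF[OF \<pi>m]
  have [measurable]: "\<pi>' i \<in> borel_measurable M" for i unfolding \<pi>'_def by simp
  have Whm: "Wh \<in> borel_measurable F"
    unfolding Wh_def using Y \<pi>m by (intro borel_measurable_sum borel_measurable_times) auto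
  have \<psi>m: "\<psi> \<in> borel_measurable F" unfolding \<psi>_def using \<phi>(1) Whm by (intro borel_measurable_divide)
  note [measurable] = fromF[OF Whm] fromF[OF \<psi>m]
  have YM: "Y i \<in> borel_measurable M" if "i \<in> I" for i using fromF(1)[OF Y[OF that]] .
  have indM: "(indicator (A i) :: 'a \<Rightarrow> real) \<in> borel_measurable M" if "i \<in> I" for i
    using A[OF that] by simp
  \<comment> \<open>A sum over an infinite set is 0 by convention, so on a nonempty space the
    partition of unity forces finiteness.\<close>
  have finI: "finite I"
    using part not_empty by (metis ex_in_conv sum.infinite zero_neq_one)

  \<comment> \<open>Posterior probabilities and almost sure bounds\<close>
  have \<pi>01: "AE \<omega> in M. \<forall>i\<in>I. 0 \<le> \<pi> i \<omega> \<and> \<pi> i \<omega> \<le> 1"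
    unfolding \<pi>_def using A by (intro AE_finite_allI finI real_cond_exp_indicator_bounds F)
  have \<pi>'01: "AE \<omega> in M. \<forall>i\<in>I. 0 \<le> \<pi>' i \<omega> \<and> \<pi>' i \<omega> \<le> 1"
    unfolding \<pi>'_def using A by (intro AE_finite_allI finI real_cond_exp_indicator_bounds F')
  have \<pi>sum: "AE \<omega> in M. (\<Sum>i\<in>I. \<pi> i \<omega>) = 1"
  proof -
    interpret sigma_finite_subalgebra M F by (rule sigma_finite_subalgebra_prob[OF F])
    \<comment> \<open>The family is extended by zero outside \<open>I\<close>, because
      \<open>real_cond_exp_sum\<close> asks for integrability at every index.\<close>
    define J where "J i = (if i \<in> I then indicator (A i) else (\<lambda>_. 0::real))" for i
    have "AE \<omega> in M. real_cond_exp M F (\<lambda>\<omega>. \<Sum>i\<in>I. J i \<omega>) \<omega> = (\<Sum>i\<in>I. real_cond_exp M F (J i) \<omega>)"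
      using A by (intro real_cond_exp_sum) (auto simp: J_def integrable_indicator_event)
    moreover have "AE \<omega> in M. real_cond_exp M F (\<lambda>\<omega>. \<Sum>i\<in>I. J i \<omega>) \<omega> = real_cond_exp M F (\<lambda>_. 1) \<omega>"
      using part A by (intro real_cond_exp_cong AE_I2 borel_measurable_sum) (auto simp: J_def)
    moreover have "AE \<omega> in M. real_cond_exp M F (\<lambda>_. 1::real) \<omega> = 1"
      by (intro real_cond_exp_F_meas) auto
    ultimately show ?thesis by eventually_elim (simp add: J_def \<pi>_def)
  qed
  have Whb: "AE \<omega> in M. c \<le> Wh \<omega> \<and> Wh \<omega> \<le> C"
    using \<pi>01 \<pi>sum
  proof eventually_elim
    case (elim \<omega>)
    have "(\<Sum>i\<in>I. \<pi> i \<omega> * c) \<le> Wh \<omega>" "Wh \<omega> \<le> (\<Sum>i\<in>I. \<pi> i \<omega> * C)"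
      unfolding Wh_def using elim(1) Yb by (auto intro!: sum_mono mult_left_mono)
    then show ?case using elim(2) by (simp add: sum_distrib_right[symmetric])
  qed
  have \<phi>b: "AE \<omega> in M. \<bar>\<phi> \<omega>\<bar> \<le> G"
    using real_cond_exp_abs_le[OF F g] \<phi>(2) by eventually_elim simp
  have G0: "G \<ge> 0"
  proof -
    have "AE \<omega> in M. 0 \<le> G" using \<phi>b by eventually_elim (simp add: order_trans[OF abs_ge_zero])
    then show ?thesis by (simp add: AE_const)
  qed
  have H0: "H \<ge> 0"
  proof -
    have "AE \<omega> in M. 0 \<le> H" using h(2) by eventually_elim (simp add: order_trans[OF abs_ge_zero])
    then show ?thesis by (simp add: AE_const)
  qed
  have \<psi>b: "AE \<omega> in M. \<bar>\<psi> \<omega>\<bar> \<le> G / c"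
    using \<phi>b Whb
  proof eventually_elim
    case (elim \<omega>)
    then show ?case unfolding \<psi>_def abs_divide using c G0 by (intro frac_le) auto
  qed
  have \<psi>Wh: "AE \<omega> in M. \<psi> \<omega> * Wh \<omega> = \<phi> \<omega>"
    using Whb by eventually_elim (use c in \<open>auto simp: \<psi>_def\<close>)
  have Wb: "AE \<omega> in M. \<bar>W \<omega>\<bar> \<le> C"
    using W(2) AE_space
  proof eventually_elim
    case (elim \<omega>)
    have "\<bar>Y i \<omega>\<bar> \<le> C" if "i \<in> I" for i
      using Yb[OF that, of \<omega>] c by linarith
    then have "\<bar>\<Sum>i\<in>I. Y i \<omega> * indicator (A i) \<omega>\<bar> \<le> (\<Sum>i\<in>I. C * indicator (A i) \<omega>)"
      by (intro sum_abs[THEN order_trans] sum_mono) (auto simp: indicator_def)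
    also have "\<dots> = C" using part[OF elim(2)] by (simp add: sum_distrib_left[symmetric])
    finally show ?case using elim(1) by simp
  qed
  have W'b: "AE \<omega> in M. \<bar>W' \<omega>\<bar> \<le> C + \<delta>"
    using Wb W'(2) by eventually_elim linarith

  \<comment> \<open>Integrability of products of bounded variables\<close>
  have mb: "AE \<omega> in M. \<bar>u \<omega> * w \<omega>\<bar> \<le> a * b"
    if "AE \<omega> in M. \<bar>u \<omega>\<bar> \<le> a" "AE \<omega> in M. \<bar>w \<omega>\<bar> \<le> b" for u w :: "'a \<Rightarrow> real" and a b
    using that by eventually_elim (auto simp: abs_mult intro!: mult_mono order_trans[OF abs_ge_zero])
  have intb: "integrable M u" if "AE \<omega> in M. \<bar>u \<omega>\<bar> \<le> a" "u \<in> borel_measurable M"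
    for u :: "'a \<Rightarrow> real" and a
    using that by (intro integrable_const_bound[of _ a]) auto
  have Yab: "AE \<omega> in M. \<bar>Y i \<omega>\<bar> \<le> C" if "i \<in> I" for i
    using Yb[OF that] c by (intro AE_I2) (smt (verit))
  have indb: "AE \<omega> in M. \<bar>indicator (A i) \<omega> :: real\<bar> \<le> 1" for i by (intro AE_I2) (simp add: indicator_def)
  have \<pi>b: "AE \<omega> in M. \<bar>\<pi> i \<omega>\<bar> \<le> 1" "AE \<omega> in M. \<bar>\<pi>' i \<omega>\<bar> \<le> 1" if "i \<in> I" for i
    using eventually_mono[OF \<pi>01, of "\<lambda>\<omega>. \<bar>\<pi> i \<omega>\<bar> \<le> 1"]
      eventually_mono[OF \<pi>'01, of "\<lambda>\<omega>. \<bar>\<pi>' i \<omega>\<bar> \<le> 1"] that by auto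

  \<comment> \<open>The scale is expanded over the hidden events. All other factors are
    \<open>S\<close>-measurable, so each indicator can be replaced by its posterior given
    \<open>S\<close>. It is used with \<open>F\<close> for the old step and with \<open>F'\<close>
    for the new one.\<close>
  have split: "(\<integral>\<omega>. \<psi> \<omega> * W \<omega> * u \<omega> \<partial>M) = (\<Sum>i\<in>I. \<integral>\<omega>. (\<psi> \<omega> * Y i \<omega> * u \<omega>) * real_cond_exp M S (indicator (A i)) \<omega> \<partial>M)"
    if S: "subalgebra M S" "subalgebra S F" and u: "u \<in> borel_measurable S" "AE \<omega> in M. \<bar>u \<omega>\<bar> \<le> H" for S u
  proof -
    interpret sigma_finite_subalgebra M S by (rule sigma_finite_subalgebra_prob[OF S(1)])
    have uM[measurable]: "u \<in> borel_measurable M" using measurable_from_subalg[OF S(1) u(1)] .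
    have int: "integrable M (\<lambda>\<omega>. (\<psi> \<omega> * Y i \<omega> * u \<omega>) * indicator (A i) \<omega>)" if i: "i \<in> I" for i
      using YM[OF i] indM[OF i] uM by (intro intb[OF mb[OF mb[OF mb[OF \<psi>b Yab[OF i]] u(2)] indb]]) measurable
    have "(\<integral>\<omega>. \<psi> \<omega> * W \<omega> * u \<omega> \<partial>M) = (\<integral>\<omega>. (\<Sum>i\<in>I. (\<psi> \<omega> * Y i \<omega> * u \<omega>) * indicator (A i) \<omega>) \<partial>M)"
    proof (rule integral_cong_AE)
      show "AE \<omega> in M. \<psi> \<omega> * W \<omega> * u \<omega> = (\<Sum>i\<in>I. (\<psi> \<omega> * Y i \<omega> * u \<omega>) * indicator (A i) \<omega>)"
        using W(2) by eventually_elim (simp add: sum_distrib_left sum_distrib_right mult_ac)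
      show "(\<lambda>\<omega>. \<Sum>i\<in>I. (\<psi> \<omega> * Y i \<omega> * u \<omega>) * indicator (A i) \<omega>) \<in> borel_measurable M"
        using int by (intro borel_measurable_sum) auto
    qed measurable
    also have "\<dots> = (\<Sum>i\<in>I. \<integral>\<omega>. (\<psi> \<omega> * Y i \<omega> * u \<omega>) * indicator (A i) \<omega> \<partial>M)"
      using int by (intro Bochner_Integration.integral_sum)
    also have "\<dots> = (\<Sum>i\<in>I. \<integral>\<omega>. (\<psi> \<omega> * Y i \<omega> * u \<omega>) * real_cond_exp M S (indicator (A i)) \<omega> \<partial>M)"
    proof (intro sum.cong refl real_cond_exp_intg(2)[symmetric] int indM)
      fix i assume i: "i \<in> I"
      show "(\<lambda>\<omega>. \<psi> \<omega> * Y i \<omega> * u \<omega>) \<in> borel_measurable S"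
        using measurable_from_subalg[OF S(2) \<psi>m] measurable_from_subalg[OF S(2) Y[OF i]] u(1)
        by (intro borel_measurable_times)
    qed auto
    finally show ?thesis .
  qed
  have intY: "integrable M (\<lambda>\<omega>. (\<psi> \<omega> * Y i \<omega> * u \<omega>) * \<pi> i \<omega>)"
    if "i \<in> I" "u \<in> borel_measurable M" "AE \<omega> in M. \<bar>u \<omega>\<bar> \<le> H" for i u
    using YM[OF that(1)] that(2) fromF(1)[OF \<pi>m, of i] by (intro intb[OF mb[OF mb[OF mb[OF \<psi>b Yab] that(3)] \<pi>b(1)]] that) measurable
  \<comment> \<open>With the posteriors given \<open>F\<close> the sum reassembles to
    \<open>Wh\<close>, which cancels the denominator of \<psi>.\<close>
  have collect: "(\<Sum>i\<in>I. \<integral>\<omega>. (\<psi> \<omega> * Y i \<omega> * u \<omega>) * \<pi> i \<omega> \<partial>M) = (\<integral>\<omega>. \<phi> \<omega> * u \<omega> \<partial>M)"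
    if [measurable]: "u \<in> borel_measurable M" and u: "AE \<omega> in M. \<bar>u \<omega>\<bar> \<le> H" for u
  proof -
    have "(\<Sum>i\<in>I. \<integral>\<omega>. (\<psi> \<omega> * Y i \<omega> * u \<omega>) * \<pi> i \<omega> \<partial>M) = (\<integral>\<omega>. (\<Sum>i\<in>I. (\<psi> \<omega> * Y i \<omega> * u \<omega>) * \<pi> i \<omega>) \<partial>M)"
      using intY[OF _ that] by (intro Bochner_Integration.integral_sum[symmetric])
    also have "\<dots> = (\<integral>\<omega>. \<psi> \<omega> * Wh \<omega> * u \<omega> \<partial>M)"
      by (intro Bochner_Integration.integral_cong)
         (auto simp: Wh_def sum_distrib_left sum_distrib_right mult_ac)
    also have "\<dots> = (\<integral>\<omega>. \<phi> \<omega> * u \<omega> \<partial>M)"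
    proof (rule integral_cong_AE)
      show "AE \<omega> in M. \<psi> \<omega> * Wh \<omega> * u \<omega> = \<phi> \<omega> * u \<omega>" using \<psi>Wh by eventually_elim simp
    qed measurable
    finally show ?thesis .
  qed
  have FF: "subalgebra F F" by (simp add: subalgebra_def)

  \<comment> \<open>The recursion tested with \<psi>, term by term\<close>
  have e1: "(\<integral>\<omega>. \<psi> \<omega> * W \<omega> * h0 \<omega> \<partial>M) = (\<integral>\<omega>. \<phi> \<omega> * h0 \<omega> \<partial>M)"
    using split[OF F FF h0] collect[OF _ h0(2)] by (simp add: \<pi>_def)

  \<comment> \<open>The new step is only \<open>F'\<close>-measurable, so \<open>split\<close>
    produces the revised posteriors. Going back to those given \<open>F\<close> costs at most
    \<open>G / c * C * H\<close> times their distance in mean, which sums over \<open>I\<close> to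
    \<open>R\<close>.\<close>
  have e2: "(\<integral>\<omega>. \<psi> \<omega> * W \<omega> * h \<omega> \<partial>M) \<le> (\<integral>\<omega>. \<phi> \<omega> * h \<omega> \<partial>M) + G / c * H * C * R"
  proof -
    have "(\<integral>\<omega>. (\<psi> \<omega> * Y i \<omega> * h \<omega>) * \<pi>' i \<omega> \<partial>M)
        \<le> (\<integral>\<omega>. (\<psi> \<omega> * Y i \<omega> * h \<omega>) * \<pi> i \<omega> \<partial>M) + G / c * C * H * (\<integral>\<omega>. \<bar>\<pi>' i \<omega> - \<pi> i \<omega>\<bar> \<partial>M)"
      if i: "i \<in> I" for i
    proof -
      note [measurable] = YM[OF i]
      have d: "integrable M (\<lambda>\<omega>. \<bar>\<pi>' i \<omega> - \<pi> i \<omega>\<bar>)"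
        by (intro integrable_abs Bochner_Integration.integrable_diff intb[OF \<pi>b(1)[OF i]] intb[OF \<pi>b(2)[OF i]]) measurable
      have "(\<integral>\<omega>. (\<psi> \<omega> * Y i \<omega> * h \<omega>) * \<pi>' i \<omega> \<partial>M)
        \<le> (\<integral>\<omega>. (\<psi> \<omega> * Y i \<omega> * h \<omega>) * \<pi> i \<omega> + G / c * C * H * \<bar>\<pi>' i \<omega> - \<pi> i \<omega>\<bar> \<partial>M)"
      proof (rule integral_mono_AE)
        show "integrable M (\<lambda>\<omega>. (\<psi> \<omega> * Y i \<omega> * h \<omega>) * \<pi>' i \<omega>)"
          by (intro intb[OF mb[OF mb[OF mb[OF \<psi>b Yab[OF i]] h(2)] \<pi>b(2)[OF i]]]) measurable
        show "integrable M (\<lambda>\<omega>. (\<psi> \<omega> * Y i \<omega> * h \<omega>) * \<pi> i \<omega> + G / c * C * H * \<bar>\<pi>' i \<omega> - \<pi> i \<omega>\<bar>)"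
          using intY[OF i _ h(2)] d by simp
        show "AE \<omega> in M. (\<psi> \<omega> * Y i \<omega> * h \<omega>) * \<pi>' i \<omega>
          \<le> (\<psi> \<omega> * Y i \<omega> * h \<omega>) * \<pi> i \<omega> + G / c * C * H * \<bar>\<pi>' i \<omega> - \<pi> i \<omega>\<bar>"
          using mb[OF mb[OF \<psi>b Yab[OF i]] h(2)]
        proof eventually_elim
          case (elim \<omega>)
          have "(\<psi> \<omega> * Y i \<omega> * h \<omega>) * (\<pi>' i \<omega> - \<pi> i \<omega>) \<le> \<bar>(\<psi> \<omega> * Y i \<omega> * h \<omega>) * (\<pi>' i \<omega> - \<pi> i \<omega>)\<bar>" by simp
          also have "\<dots> \<le> G / c * C * H * \<bar>\<pi>' i \<omega> - \<pi> i \<omega>\<bar>"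
            unfolding abs_mult[of "\<psi> \<omega> * Y i \<omega> * h \<omega>"] using elim by (intro mult_right_mono) auto
          finally show ?case by (simp only: right_diff_distrib)
        qed
      qed
      then show ?thesis using intY[OF i _ h(2)] d by simp
    qed
    then have "(\<Sum>i\<in>I. \<integral>\<omega>. (\<psi> \<omega> * Y i \<omega> * h \<omega>) * \<pi>' i \<omega> \<partial>M)
      \<le> (\<Sum>i\<in>I. (\<integral>\<omega>. (\<psi> \<omega> * Y i \<omega> * h \<omega>) * \<pi> i \<omega> \<partial>M) + G / c * C * H * (\<integral>\<omega>. \<bar>\<pi>' i \<omega> - \<pi> i \<omega>\<bar> \<partial>M))"
      by (rule sum_mono)
    also have "\<dots> = (\<Sum>i\<in>I. \<integral>\<omega>. (\<psi> \<omega> * Y i \<omega> * h \<omega>) * \<pi> i \<omega> \<partial>M)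
      + G / c * C * H * (\<Sum>i\<in>I. \<integral>\<omega>. \<bar>\<pi>' i \<omega> - \<pi> i \<omega>\<bar> \<partial>M)"
      by (simp only: sum.distrib sum_distrib_left)
    also have "\<dots> = (\<integral>\<omega>. \<phi> \<omega> * h \<omega> \<partial>M) + G / c * C * H * R"
      using collect[OF _ h(2)] by (simp add: R_def \<pi>_def[symmetric] \<pi>'_def[symmetric])
    finally show ?thesis using split[OF F' FF' h] by (simp add: \<pi>'_def mult_ac)
  qed

  have e3: "(\<integral>\<omega>. \<psi> \<omega> * W' \<omega> * h \<omega> \<partial>M) \<le> (\<integral>\<omega>. \<psi> \<omega> * W \<omega> * h \<omega> \<partial>M) + G / c * H * \<delta>"
  proof -
    have "(\<integral>\<omega>. \<psi> \<omega> * W' \<omega> * h \<omega> \<partial>M) \<le> (\<integral>\<omega>. \<psi> \<omega> * W \<omega> * h \<omega> + G / c * \<delta> * H \<partial>M)"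
    proof (rule integral_mono_AE)
      show "integrable M (\<lambda>\<omega>. \<psi> \<omega> * W' \<omega> * h \<omega>)"
        by (intro intb[OF mb[OF mb[OF \<psi>b W'b] h(2)]]) measurable
      show "integrable M (\<lambda>\<omega>. \<psi> \<omega> * W \<omega> * h \<omega> + G / c * \<delta> * H)"
        using intb[OF mb[OF mb[OF \<psi>b Wb] h(2)]] by simp
      show "AE \<omega> in M. \<psi> \<omega> * W' \<omega> * h \<omega> \<le> \<psi> \<omega> * W \<omega> * h \<omega> + G / c * \<delta> * H"
        using mb[OF mb[OF \<psi>b W'(2)] h(2)]
      proof eventually_elim
        case (elim \<omega>)
        have "\<psi> \<omega> * W' \<omega> * h \<omega> - \<psi> \<omega> * W \<omega> * h \<omega> = \<psi> \<omega> * (W' \<omega> - W \<omega>) * h \<omega>" by (simp add: algebra_simps)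
        then show ?case using elim by linarith
      qed
    qed
    also have "\<dots> = (\<integral>\<omega>. \<psi> \<omega> * W \<omega> * h \<omega> \<partial>M) + G / c * \<delta> * H"
      using intb[OF mb[OF mb[OF \<psi>b Wb] h(2)]] by (simp add: prob_space)
    finally show ?thesis by (simp add: mult_ac)
  qed

  have e4: "(\<integral>\<omega>. \<psi> \<omega> * W' \<omega> * h \<omega> \<partial>M) = \<beta> * (\<integral>\<omega>. \<psi> \<omega> * W \<omega> * h0 \<omega> \<partial>M) + (1 - \<beta>) * (\<integral>\<omega>. \<psi> \<omega> * g \<omega> \<partial>M)"
  proof -
    have "(\<integral>\<omega>. \<psi> \<omega> * W' \<omega> * h \<omega> \<partial>M) = (\<integral>\<omega>. \<beta> * (\<psi> \<omega> * W \<omega> * h0 \<omega>) + (1 - \<beta>) * (\<psi> \<omega> * g \<omega>) \<partial>M)"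
    proof (rule integral_cong_AE)
      show "AE \<omega> in M. \<psi> \<omega> * W' \<omega> * h \<omega> = \<beta> * (\<psi> \<omega> * W \<omega> * h0 \<omega>) + (1 - \<beta>) * (\<psi> \<omega> * g \<omega>)"
        using rec
      proof eventually_elim
        case (elim \<omega>)
        have "\<psi> \<omega> * W' \<omega> * h \<omega> = \<psi> \<omega> * (W' \<omega> * h \<omega>)" by simp
        then show ?case unfolding elim by (simp add: algebra_simps)
      qed
    qed measurable
    also have "\<dots> = \<beta> * (\<integral>\<omega>. \<psi> \<omega> * W \<omega> * h0 \<omega> \<partial>M) + (1 - \<beta>) * (\<integral>\<omega>. \<psi> \<omega> * g \<omega> \<partial>M)"
      using intb[OF mb[OF mb[OF \<psi>b Wb] h0(2)]] intb[OF mb[OF \<psi>b g(2)]] by simp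
    finally show ?thesis .
  qed

  \<comment> \<open>As \<psi> is \<open>F\<close>-measurable, \<open>g\<close> may be replaced by
    its conditional expectation \<phi>; then \<open>\<psi> * \<phi> = \<phi>\<^sup>2 / Wh\<close>,
    and \<open>Wh \<le> C\<close>.\<close>
  have e5: "(\<integral>\<omega>. \<psi> \<omega> * g \<omega> \<partial>M) \<ge> 1 / C * (\<integral>\<omega>. (\<phi> \<omega>)\<^sup>2 \<partial>M)"
  proof -
    interpret sigma_finite_subalgebra M F by (rule sigma_finite_subalgebra_prob[OF F])
    have ig: "integrable M (\<lambda>\<omega>. \<psi> \<omega> * g \<omega>)" using intb[OF mb[OF \<psi>b g(2)]] by simp
    have "(\<integral>\<omega>. \<psi> \<omega> * g \<omega> \<partial>M) = (\<integral>\<omega>. \<psi> \<omega> * real_cond_exp M F g \<omega> \<partial>M)"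
      using real_cond_exp_intg(2)[OF ig \<psi>m] by simp
    also have "\<dots> = (\<integral>\<omega>. \<psi> \<omega> * \<phi> \<omega> \<partial>M)"
    proof (rule integral_cong_AE)
      show "AE \<omega> in M. \<psi> \<omega> * real_cond_exp M F g \<omega> = \<psi> \<omega> * \<phi> \<omega>" using \<phi>(2) by eventually_elim simp
    qed measurable
    finally have eq: "(\<integral>\<omega>. \<psi> \<omega> * g \<omega> \<partial>M) = (\<integral>\<omega>. \<psi> \<omega> * \<phi> \<omega> \<partial>M)" .
    have i2: "integrable M (\<lambda>\<omega>. (\<phi> \<omega>)\<^sup>2)" using intb[OF mb[OF \<phi>b \<phi>b]] by (simp add: power2_eq_square)
    have "1 / C * (\<integral>\<omega>. (\<phi> \<omega>)\<^sup>2 \<partial>M) = (\<integral>\<omega>. 1 / C * (\<phi> \<omega>)\<^sup>2 \<partial>M)" by simp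
    also have "\<dots> \<le> (\<integral>\<omega>. \<psi> \<omega> * \<phi> \<omega> \<partial>M)"
    proof (rule integral_mono_AE)
      show "integrable M (\<lambda>\<omega>. 1 / C * (\<phi> \<omega>)\<^sup>2)" using i2 by simp
      show "integrable M (\<lambda>\<omega>. \<psi> \<omega> * \<phi> \<omega>)" using intb[OF mb[OF \<psi>b \<phi>b]] by simp
      show "AE \<omega> in M. 1 / C * (\<phi> \<omega>)\<^sup>2 \<le> \<psi> \<omega> * \<phi> \<omega>"
        using Whb
      proof eventually_elim
        case (elim \<omega>)
        have "(\<phi> \<omega>)\<^sup>2 / C \<le> (\<phi> \<omega>)\<^sup>2 / Wh \<omega>" using elim c by (intro divide_left_mono) auto
        then show ?case by (simp add: \<psi>_def power2_eq_square)
      qed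
    qed
    finally show ?thesis by (simp add: eq)
  qed
  have "(1 - \<beta>) * (1 / C * (\<integral>\<omega>. (\<phi> \<omega>)\<^sup>2 \<partial>M)) \<le> (1 - \<beta>) * (\<integral>\<omega>. \<psi> \<omega> * g \<omega> \<partial>M)"
    using e5 \<beta> by (intro mult_left_mono) auto
  then have "(1 - \<beta>) / C * (\<integral>\<omega>. (\<phi> \<omega>)\<^sup>2 \<partial>M) \<le> (1 - \<beta>) * (\<integral>\<omega>. \<psi> \<omega> * g \<omega> \<partial>M)" by simp
  moreover have "(1 - \<beta>) * (\<integral>\<omega>. \<psi> \<omega> * g \<omega> \<partial>M)
      \<le> (\<integral>\<omega>. \<phi> \<omega> * h \<omega> \<partial>M) + (G / c * H * C * R + G / c * H * \<delta>) - \<beta> * (\<integral>\<omega>. \<phi> \<omega> * h0 \<omega> \<partial>M)"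
    using e2 e3 unfolding e4 e1 by simp
  moreover have "G / c * H * C * R + G / c * H * \<delta> = G / c * H * (\<delta> + C * R)"
    by (simp only: distrib_left mult.assoc add.commute)
  ultimately show ?thesis by simp
qed

section \<open>One coordinate of Adam\<close>

text \<open>Each moment is a convex combination of its predecessor and the new gradient or its
  square, so the bounds propagate by induction.\<close>

lemma adam_moment_bounds:
  fixes m v g \<beta> \<theta> :: "nat \<Rightarrow> real"
  assumes 0: "m 0 = 0" "v 0 = 0"
    and m: "\<And>k. m (Suc k) = \<beta> (Suc k) * m k + (1 - \<beta> (Suc k)) * g (Suc k)"
    and v: "\<And>k. v (Suc k) = \<theta> (Suc k) * v k + (1 - \<theta> (Suc k)) * (g (Suc k))\<^sup>2"
    and \<beta>: "\<And>k. 0 \<le> \<beta> (Suc k) \<and> \<beta> (Suc k) \<le> 1" and \<theta>: "\<And>k. 0 \<le> \<theta> (Suc k) \<and> \<theta> (Suc k) \<le> 1"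
    and g: "\<And>k. \<bar>g (Suc k)\<bar> \<le> G"
  shows "\<bar>m k\<bar> \<le> G \<and> 0 \<le> v k \<and> v k \<le> G\<^sup>2"
proof (induction k)
  case 0
  have "G \<ge> 0" using g[of 0] by linarith
  then show ?case by (simp add: assms(1,2))
next
  case (Suc k)
  have cvx: "t * a + (1 - t) * b \<le> c" if "0 \<le> t \<and> t \<le> 1" "a \<le> c" "b \<le> c" for t a b c :: real
  proof -
    have "t * a + (1 - t) * b \<le> t * c + (1 - t) * c"
      using that by (intro add_mono mult_left_mono) auto
    then show ?thesis by (simp add: algebra_simps)
  qed
  have g2: "(g (Suc k))\<^sup>2 \<le> G\<^sup>2" using g[of k] by (simp add: abs_le_square_iff[symmetric])
  have "\<bar>m (Suc k)\<bar> \<le> \<beta> (Suc k) * \<bar>m k\<bar> + (1 - \<beta> (Suc k)) * \<bar>g (Suc k)\<bar>"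
    unfolding m using \<beta>[of k] by (intro abs_triangle_ineq[THEN order_trans]) (simp add: abs_mult)
  also have "\<dots> \<le> G" using Suc g by (intro cvx \<beta>) auto
  finally show ?case unfolding v using Suc \<theta>[of k] g2 by (auto intro!: cvx add_nonneg_nonneg)
qed

lemma abs_sqrt_diff_le:
  fixes a b e :: real
  assumes "e > 0" "a \<ge> e" "b \<ge> e"
  shows "\<bar>sqrt a - sqrt b\<bar> \<le> \<bar>a - b\<bar> / sqrt e"
proof -
  have "\<bar>sqrt a - sqrt b\<bar> * sqrt e \<le> \<bar>sqrt a - sqrt b\<bar> * (sqrt a + sqrt b)"
    using assms by (intro mult_left_mono) (auto intro: order_trans[OF real_sqrt_le_mono])
  also have "\<dots> = \<bar>(sqrt a - sqrt b) * (sqrt a + sqrt b)\<bar>"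
    using assms by (simp add: abs_mult)
  also have "(sqrt a - sqrt b) * (sqrt a + sqrt b) = a - b"
    using assms by (simp add: algebra_simps)
  finally show ?thesis using assms by (simp add: field_simps)
qed

lemma borel_measurable_recover_grad [measurable (raw)]:
  assumes [measurable]: "a \<in> borel_measurable N" "c \<in> borel_measurable N" "y \<in> borel_measurable N"
  shows "(\<lambda>\<omega>. recover_grad (a \<omega>) b (c \<omega>) d \<sigma> (y \<omega>)) \<in> borel_measurable N"
  unfolding recover_grad_def by measurable

text \<open>The moments \<open>(m k, v k)\<close> read off from the steps \<open>y\<close>, when \<open>T\<close> is the set of times at
  which the second root was taken.\<close>

primrec moments_from_steps ::
    "(nat \<Rightarrow> real) \<Rightarrow> (nat \<Rightarrow> real) \<Rightarrow> real \<Rightarrow> nat set \<Rightarrow> (nat \<Rightarrow> real) \<Rightarrow> nat \<Rightarrow> real \<times> real" where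
  "moments_from_steps \<beta> \<theta> \<epsilon> T y 0 = (0, 0)"
| "moments_from_steps \<beta> \<theta> \<epsilon> T y (Suc k) =
    (let m = fst (moments_from_steps \<beta> \<theta> \<epsilon> T y k); v = snd (moments_from_steps \<beta> \<theta> \<epsilon> T y k);
         g = recover_grad (\<beta> (Suc k) * m) (1 - \<beta> (Suc k)) (\<theta> (Suc k) * v + \<epsilon>) (1 - \<theta> (Suc k))
               (if Suc k \<in> T then - 1 else 1) (y (Suc k))
     in (\<beta> (Suc k) * m + (1 - \<beta> (Suc k)) * g, \<theta> (Suc k) * v + (1 - \<theta> (Suc k)) * g\<^sup>2))"

lemma measurable_moments_from_steps:
  fixes h :: "nat \<Rightarrow> 'a \<Rightarrow> real"
  assumes "\<And>j. j \<le> k \<Longrightarrow> h j \<in> borel_measurable N"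
  shows "(\<lambda>\<omega>. fst (moments_from_steps \<beta> \<theta> \<epsilon> T (\<lambda>j. h j \<omega>) k)) \<in> borel_measurable N \<and>
    (\<lambda>\<omega>. snd (moments_from_steps \<beta> \<theta> \<epsilon> T (\<lambda>j. h j \<omega>) k)) \<in> borel_measurable N"
  using assms
proof (induction k)
  case (Suc k)
  have [measurable]: "(\<lambda>\<omega>. fst (moments_from_steps \<beta> \<theta> \<epsilon> T (\<lambda>j. h j \<omega>) k)) \<in> borel_measurable N"
    "(\<lambda>\<omega>. snd (moments_from_steps \<beta> \<theta> \<epsilon> T (\<lambda>j. h j \<omega>) k)) \<in> borel_measurable N"
    "h (Suc k) \<in> borel_measurable N"
    using Suc by auto
  show ?case by (simp add: Let_def)
qed simp

text \<open>With \<open>T\<close> collecting exactly the times of negative sign in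
  \<open>recover_grad_eq\<close>, the replay picks the true root at every time, so by induction it
  never leaves the true moments.\<close>

lemma moments_from_steps_eq:
  fixes m v g \<beta> \<theta> :: "nat \<Rightarrow> real"
  assumes 0: "m 0 = 0" "v 0 = 0"
    and m: "\<And>k. m (Suc k) = \<beta> (Suc k) * m k + (1 - \<beta> (Suc k)) * g (Suc k)"
    and v: "\<And>k. v (Suc k) = \<theta> (Suc k) * v k + (1 - \<theta> (Suc k)) * (g (Suc k))\<^sup>2"
    and \<beta>: "\<And>k. \<beta> (Suc k) < 1" and \<theta>: "\<And>k. 0 \<le> \<theta> (Suc k) \<and> \<theta> (Suc k) < 1"
    and \<epsilon>: "\<epsilon> > 0" and v0: "\<And>k. v k \<ge> 0"
    and T: "\<And>k. Suc k \<in> T \<longleftrightarrow>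
      (1 - \<beta> (Suc k)) * (\<theta> (Suc k) * v k + \<epsilon>) - \<beta> (Suc k) * m k * (1 - \<theta> (Suc k)) * g (Suc k) < 0"
  shows "moments_from_steps \<beta> \<theta> \<epsilon> T (\<lambda>k. m k / sqrt (v k + \<epsilon>)) k = (m k, v k)"
proof (induction k)
  case (Suc k)
  have "\<theta> (Suc k) * v k + \<epsilon> > 0"
    using \<theta>[of k] \<epsilon> v0[of k] by (intro add_nonneg_pos mult_nonneg_nonneg) auto
  then have "recover_grad (\<beta> (Suc k) * m k) (1 - \<beta> (Suc k)) (\<theta> (Suc k) * v k + \<epsilon>) (1 - \<theta> (Suc k))
          (if Suc k \<in> T then - 1 else 1) (m (Suc k) / sqrt (v (Suc k) + \<epsilon>)) = g (Suc k)"
    unfolding T using \<beta>[of k] \<theta>[of k] by (intro recover_grad_eq) (auto simp: m v add_ac)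
  then show ?case using Suc by (simp add: m v Let_def)
qed (simp add: 0)

text \<open>Here \<open>hidden_scale_step\<close> is applied to the scale
  \<open>sqrt (v k + \<epsilon>)\<close>, the hidden events being the possible root choices at
  finitely many early times. The error \<open>e\<close> collects the drift of the scale and the
  revision of the posteriors, both summable against \<eta>.\<close>

lemma (in prob_space) adam_coordinate_step:
  fixes h m v g \<phi> :: "nat \<Rightarrow> 'a \<Rightarrow> real" and \<beta> \<theta> \<eta> :: "nat \<Rightarrow> real"
  assumes F: "\<And>k. subalgebra M (F k)" "\<And>k. subalgebra (F (Suc k)) (F k)"
    and hF: "\<And>k. h k \<in> borel_measurable (F (Suc k))"
    and gM: "\<And>k. g (Suc k) \<in> borel_measurable M"
    and init: "\<And>\<omega>. \<omega> \<in> space M \<Longrightarrow> m 0 \<omega> = 0 \<and> v 0 \<omega> = 0"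
    and m: "\<And>k \<omega>. \<omega> \<in> space M \<Longrightarrow> m (Suc k) \<omega> = \<beta> (Suc k) * m k \<omega> + (1 - \<beta> (Suc k)) * g (Suc k) \<omega>"
    and v: "\<And>k \<omega>. \<omega> \<in> space M \<Longrightarrow> v (Suc k) \<omega> = \<theta> (Suc k) * v k \<omega> + (1 - \<theta> (Suc k)) * (g (Suc k) \<omega>)\<^sup>2"
    and h: "\<And>k \<omega>. \<omega> \<in> space M \<Longrightarrow> h k \<omega> = m k \<omega> / sqrt (v k \<omega> + \<epsilon>)"
    and \<epsilon>: "\<epsilon> > 0"
    and \<beta>: "\<And>k. 0 \<le> \<beta> (Suc k) \<and> \<beta> (Suc k) \<le> \<beta>max" and \<beta>max: "\<beta>max < 1"
    and \<theta>: "\<And>k. 0 \<le> \<theta> (Suc k) \<and> \<theta> (Suc k) < 1" and \<theta>lim: "\<theta> \<longlonglongrightarrow> 1"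
    and G: "\<And>k. AE \<omega> in M. \<bar>g (Suc k) \<omega>\<bar> \<le> G" "G > 0"
    and \<phi>: "\<And>k. \<phi> k \<in> borel_measurable (F (Suc k))"
      "\<And>k. AE \<omega> in M. real_cond_exp M (F (Suc k)) (g (Suc k)) \<omega> = \<phi> k \<omega>"
    and \<eta>: "\<And>k. \<eta> k \<ge> 0" "\<And>n. (\<Sum>k=1..n. (\<eta> k)\<^sup>2) \<le> S" "\<And>n. (\<Sum>k=1..n. \<eta> k * (1 - \<theta> k)) \<le> S'"
  shows "\<exists>e E. (\<forall>k. e k \<ge> 0) \<and> (\<forall>n. (\<Sum>k=1..n. \<eta> k * e k) \<le> E) \<and>
    (\<forall>k. \<beta> (Suc k) * (\<integral>\<omega>. \<phi> k \<omega> * h k \<omega> \<partial>M) + (1 - \<beta>max) / sqrt (G\<^sup>2 + \<epsilon>) * (\<integral>\<omega>. (\<phi> k \<omega>)\<^sup>2 \<partial>M) - e (Suc k)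
        \<le> (\<integral>\<omega>. \<phi> k \<omega> * h (Suc k) \<omega> \<partial>M))"
proof -
  define c where "c = sqrt \<epsilon>"
  define C where "C = sqrt (G\<^sup>2 + \<epsilon>)"
  define H where "H = G / c"
  have c: "0 < c" "c \<le> C" using \<epsilon> by (auto simp: c_def C_def)
  have \<beta>1: "\<beta> (Suc k) < 1" for k using \<beta>[of k] \<beta>max by linarith
  have good: "AE \<omega> in M. \<omega> \<in> space M \<and> (\<forall>k. \<bar>g (Suc k) \<omega>\<bar> \<le> G)"
    using G(1) AE_space by (auto simp: AE_all_countable)
  have mv: "\<bar>m k \<omega>\<bar> \<le> G \<and> 0 \<le> v k \<omega> \<and> v k \<omega> \<le> G\<^sup>2"
    if "\<omega> \<in> space M" "\<forall>k. \<bar>g (Suc k) \<omega>\<bar> \<le> G" for k \<omega>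
    by (rule adam_moment_bounds[where \<beta> = \<beta> and \<theta> = \<theta> and g = "\<lambda>k. g k \<omega>"])
       (use that init m v \<beta> \<beta>1 \<theta> in \<open>auto intro: less_imp_le\<close>)
  have hb: "AE \<omega> in M. \<bar>h k \<omega>\<bar> \<le> H" for k
    using good
  proof eventually_elim
    case (elim \<omega>)
    have "\<bar>m k \<omega> / sqrt (v k \<omega> + \<epsilon>)\<bar> \<le> G / c"
      unfolding abs_divide c_def using mv[of \<omega> k] elim \<epsilon> G(2) by (intro frac_le) auto
    then show ?case using elim by (simp add: h H_def)
  qed
  have mvM: "m k \<in> borel_measurable M \<and> v k \<in> borel_measurable M" for k
  proof (induction k)
    case 0
    show ?case using init by (auto cong: measurable_cong)
  next
    case (Suc k)
    then have [measurable]: "m k \<in> borel_measurable M" "v k \<in> borel_measurable M" by auto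
    note [measurable] = gM[of k]
    have "(\<lambda>\<omega>. \<beta> (Suc k) * m k \<omega> + (1 - \<beta> (Suc k)) * g (Suc k) \<omega>) \<in> borel_measurable M"
      "(\<lambda>\<omega>. \<theta> (Suc k) * v k \<omega> + (1 - \<theta> (Suc k)) * (g (Suc k) \<omega>)\<^sup>2) \<in> borel_measurable M"
      by measurable
    then show ?case using m v by (auto cong: measurable_cong)
  qed
  note [measurable] = mvM[THEN conjunct1] mvM[THEN conjunct2] gM
  \<comment> \<open>\<open>D k \<omega> < 0\<close> marks the second root of the quadratic for \<open>g (Suc k)\<close>; as \<open>\<theta>\<close> tends to 1 this
    happens only for \<open>k < K0\<close>, so finitely many sets \<open>T\<close> describe everything hidden.\<close>
  define D where "D k \<omega> = (1 - \<beta> (Suc k)) * (\<theta> (Suc k) * v k \<omega> + \<epsilon>)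
    - \<beta> (Suc k) * m k \<omega> * (1 - \<theta> (Suc k)) * g (Suc k) \<omega>" for k \<omega>
  have DM[measurable]: "D k \<in> borel_measurable M" for k unfolding D_def by measurable
  \<comment> \<open>\<open>D k\<close> is almost surely at least \<open>(1 - \<beta>max) *
    \<epsilon> - (1 - \<theta> (Suc k)) * G\<^sup>2\<close>; \<open>K0\<close> is chosen so that
    this is positive from there on.\<close>
  have "(\<lambda>k. (1 - \<theta> (Suc k)) * G\<^sup>2) \<longlonglongrightarrow> (1 - 1) * G\<^sup>2"
    using LIMSEQ_Suc[OF \<theta>lim] by (intro tendsto_intros)
  then have "\<forall>\<^sub>F k in sequentially. (1 - \<theta> (Suc k)) * G\<^sup>2 < (1 - \<beta>max) * \<epsilon>"
    using \<epsilon> \<beta>max by (intro order_tendstoD(2)) auto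
  then obtain K0 where K0: "\<And>k. k \<ge> K0 \<Longrightarrow> (1 - \<theta> (Suc k)) * G\<^sup>2 < (1 - \<beta>max) * \<epsilon>"
    by (auto simp: eventually_sequentially)
  have Dpos: "D k \<omega> \<ge> 0" if "\<omega> \<in> space M" "\<forall>k. \<bar>g (Suc k) \<omega>\<bar> \<le> G" "k \<ge> K0" for k \<omega>
  proof -
    note b = mv[OF that(1,2), of k]
    have "(1 - \<beta>max) * \<epsilon> \<le> (1 - \<beta> (Suc k)) * (\<theta> (Suc k) * v k \<omega> + \<epsilon>)"
      using \<beta>[of k] \<beta>max \<theta>[of k] \<epsilon> b by (intro mult_mono) auto
    moreover have "\<beta> (Suc k) * m k \<omega> * (1 - \<theta> (Suc k)) * g (Suc k) \<omega> \<le> (1 - \<theta> (Suc k)) * G\<^sup>2"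
    proof -
      have "\<bar>\<beta> (Suc k) * m k \<omega> * g (Suc k) \<omega>\<bar> \<le> 1 * G * G"
        unfolding abs_mult using \<beta>[of k] \<beta>1[of k] b that(2) G(2) by (intro mult_mono) auto
      then have "\<beta> (Suc k) * m k \<omega> * g (Suc k) \<omega> \<le> G\<^sup>2" by (simp add: power2_eq_square)
      then have "(1 - \<theta> (Suc k)) * (\<beta> (Suc k) * m k \<omega> * g (Suc k) \<omega>) \<le> (1 - \<theta> (Suc k)) * G\<^sup>2"
        using \<theta>[of k] by (intro mult_left_mono) auto
      then show ?thesis by (simp add: mult_ac)
    qed
    ultimately show ?thesis using K0[OF that(3)] unfolding D_def by linarith
  qed
  \<comment> \<open>Times are shifted by one because \<open>D k\<close> decides the root for
    \<open>g (Suc k)\<close>. Exactly one pattern, \<open>Tof \<omega>\<close>, occurs at each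
    outcome, so the events \<open>A T\<close> form a partition.\<close>
  define I where "I = Pow (Suc ` {..<K0})"
  define A where "A T = {\<omega>\<in>space M. \<forall>k\<in>{..<K0}. D k \<omega> < 0 \<longleftrightarrow> Suc k \<in> T}" for T
  define Tof where "Tof \<omega> = Suc ` {k\<in>{..<K0}. D k \<omega> < 0}" for \<omega>
  have TofI: "Tof \<omega> \<in> I" for \<omega> by (auto simp: Tof_def I_def)
  have finI: "finite I" by (simp add: I_def)
  have A: "A T \<in> events" for T
    unfolding A_def by measurable
  have A_iff: "indicator (A T) \<omega> = (if T = Tof \<omega> then 1 else 0 :: real)" if "\<omega> \<in> space M" "T \<in> I" for T \<omega>
    using that by (auto simp: A_def Tof_def I_def indicator_def)
  have part: "(\<Sum>T\<in>I. indicator (A T) \<omega> :: real) = 1" if "\<omega> \<in> space M" for \<omega>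
    using A_iff[OF that] finI TofI[of \<omega>] by simp

  \<comment> \<open>The clamps keep the scale between \<open>c\<close> and \<open>C\<close> for
    every \<open>T\<close>, also where the replay follows wrong roots. For the true pattern they are
    almost surely inactive, since \<open>0 \<le> v k\<close> and
    \<open>v k \<le> G\<^sup>2\<close>.\<close>
  define Y where "Y k T \<omega> = min C (sqrt (max 0 (snd (moments_from_steps \<beta> \<theta> \<epsilon> T (\<lambda>j. h j \<omega>) k)) + \<epsilon>))" for k T \<omega>
  have Yb: "c \<le> Y k T \<omega> \<and> Y k T \<omega> \<le> C" for k T \<omega>
    using c(2) by (auto simp: Y_def c_def)
  have hF': "h j \<in> borel_measurable (F (Suc k))" if "j \<le> k" for j k
    using that by (induction rule: dec_induct) (auto intro: hF measurable_from_subalg[OF F(2)])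
  have YF: "Y k T \<in> borel_measurable (F (Suc k))" for k T
  proof -
    have [measurable]: "(\<lambda>\<omega>. snd (moments_from_steps \<beta> \<theta> \<epsilon> T (\<lambda>j. h j \<omega>) k)) \<in> borel_measurable (F (Suc k))"
      using measurable_moments_from_steps[of k h "F (Suc k)"] hF' by auto
    show ?thesis unfolding Y_def by measurable
  qed
  have WY: "AE \<omega> in M. sqrt (v k \<omega> + \<epsilon>) = (\<Sum>T\<in>I. Y k T \<omega> * indicator (A T) \<omega>)" for k
    using good
  proof eventually_elim
    case (elim \<omega>)
    then have sp: "\<omega> \<in> space M" and gd: "\<forall>k. \<bar>g (Suc k) \<omega>\<bar> \<le> G" by auto
    have "(\<Sum>T\<in>I. Y k T \<omega> * indicator (A T) \<omega>) = (\<Sum>T\<in>I. if T = Tof \<omega> then Y k T \<omega> else 0)"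
      using A_iff[OF sp] by (intro sum.cong) auto
    also have "\<dots> = Y k (Tof \<omega>) \<omega>" using finI TofI[of \<omega>] by simp
    also have "\<dots> = sqrt (v k \<omega> + \<epsilon>)"
    proof -
      \<comment> \<open>Beyond \<open>K0\<close> the sign is never negative, so the finite pattern
        already records all times at which the second root occurs.\<close>
      have "Suc j \<in> Tof \<omega> \<longleftrightarrow> D j \<omega> < 0" for j
        using Dpos[OF sp gd, of j] by (cases "j < K0") (auto simp: Tof_def)
      then have "moments_from_steps \<beta> \<theta> \<epsilon> (Tof \<omega>) (\<lambda>j. m j \<omega> / sqrt (v j \<omega> + \<epsilon>)) k = (m k \<omega>, v k \<omega>)"
        unfolding D_def
        by (intro moments_from_steps_eq[where g = "\<lambda>k. g k \<omega>"])
           (use sp init m v \<beta>1 \<theta> \<epsilon> mv[OF sp gd] in auto)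
      then show ?thesis using mv[OF sp gd, of k] sp by (simp add: Y_def h C_def)
    qed
    finally show ?case by simp
  qed
  \<comment> \<open>\<open>v\<close> moves by at most \<open>(1 - \<theta> k) * G\<^sup>2\<close> in
    one step, and above \<epsilon> the square root is Lipschitz with constant
    \<open>1 / c\<close>.\<close>
  define \<delta> where "\<delta> k = (1 - \<theta> k) * G\<^sup>2 / c" for k
  have W\<delta>: "AE \<omega> in M. \<bar>sqrt (v (Suc k) \<omega> + \<epsilon>) - sqrt (v k \<omega> + \<epsilon>)\<bar> \<le> \<delta> (Suc k)" for k
    using good
  proof eventually_elim
    case (elim \<omega>)
    then have sp: "\<omega> \<in> space M" and gd: "\<forall>k. \<bar>g (Suc k) \<omega>\<bar> \<le> G" by auto
    have g2: "(g (Suc k) \<omega>)\<^sup>2 \<le> G\<^sup>2" using gd G(2) by (simp add: abs_le_square_iff[symmetric])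
    have "v k \<omega> - (g (Suc k) \<omega>)\<^sup>2 \<le> G\<^sup>2" "(g (Suc k) \<omega>)\<^sup>2 - v k \<omega> \<le> G\<^sup>2"
      using mv[OF sp gd, of k] g2 zero_le_power2[of "g (Suc k) \<omega>"] by linarith+
    then have gv: "\<bar>(g (Suc k) \<omega>)\<^sup>2 - v k \<omega>\<bar> \<le> G\<^sup>2" by (intro abs_leI) auto
    have "v (Suc k) \<omega> - v k \<omega> = (1 - \<theta> (Suc k)) * ((g (Suc k) \<omega>)\<^sup>2 - v k \<omega>)"
      using v[OF sp, of k] by (simp add: algebra_simps)
    then have "\<bar>v (Suc k) \<omega> - v k \<omega>\<bar> = (1 - \<theta> (Suc k)) * \<bar>(g (Suc k) \<omega>)\<^sup>2 - v k \<omega>\<bar>"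
      using \<theta>[of k] by (simp add: abs_mult)
    also have "\<dots> \<le> (1 - \<theta> (Suc k)) * G\<^sup>2"
      using \<theta>[of k] gv by (intro mult_left_mono) auto
    finally have dv: "\<bar>v (Suc k) \<omega> - v k \<omega>\<bar> \<le> (1 - \<theta> (Suc k)) * G\<^sup>2" .
    have "\<bar>sqrt (v (Suc k) \<omega> + \<epsilon>) - sqrt (v k \<omega> + \<epsilon>)\<bar> \<le> \<bar>(v (Suc k) \<omega> + \<epsilon>) - (v k \<omega> + \<epsilon>)\<bar> / sqrt \<epsilon>"
      using mv[OF sp gd] \<epsilon> by (intro abs_sqrt_diff_le) auto
    also have "\<dots> \<le> \<delta> (Suc k)"
      unfolding \<delta>_def c_def[symmetric] using dv c by (intro divide_right_mono) auto
    finally show ?case .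
  qed
  define R where "R k = (\<Sum>T\<in>I. \<integral>\<omega>. \<bar>real_cond_exp M (F (Suc k)) (indicator (A T)) \<omega>
    - real_cond_exp M (F k) (indicator (A T)) \<omega>\<bar> \<partial>M)" for k
  \<comment> \<open>The maximum with 0 keeps \<open>e 0\<close> nonnegative although
    \<open>\<theta> 0\<close> is unconstrained. As \<open>R k\<close> compares times
    \<open>k\<close> and \<open>Suc k\<close>, \<open>e (Suc k)\<close> belongs to the passage from
    \<open>F (Suc k)\<close> to \<open>F (Suc (Suc k))\<close>.\<close>
  define e where "e k = G / c * H * (max 0 (\<delta> k) + C * R k)" for k
  have H0: "H \<ge> 0" using G(2) c by (simp add: H_def)
  have R0: "R k \<ge> 0" for k unfolding R_def by (intro sum_nonneg integral_nonneg_AE) auto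
  have "e k \<ge> 0" for k
    unfolding e_def using R0 c G(2) H0 by (intro mult_nonneg_nonneg add_nonneg_nonneg) auto
  moreover have "(\<Sum>k=1..n. \<eta> k * e k) \<le> G / c * H * (S' * G\<^sup>2 / c + C * (card I * ((S + 1) / 2)))" for n
  proof -
    \<comment> \<open>Each of the finitely many hidden events contributes at most
      \<open>(S + 1) / 2\<close>, by the martingale bound.\<close>
    have R: "(\<Sum>k=1..n. \<eta> k * R k) \<le> card I * ((S + 1) / 2)"
    proof -
      have "(\<Sum>k=1..n. \<eta> k * R k) = (\<Sum>T\<in>I. \<Sum>k=1..n. \<eta> k * (\<integral>\<omega>. \<bar>real_cond_exp M (F (Suc k)) (indicator (A T)) \<omega>
          - real_cond_exp M (F k) (indicator (A T)) \<omega>\<bar> \<partial>M))"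
        unfolding R_def sum_distrib_left by (rule sum.swap)
      also have "\<dots> \<le> (\<Sum>T\<in>I. (S + 1) / 2)"
      proof (rule sum_mono)
        fix T
        show "(\<Sum>k=1..n. \<eta> k * (\<integral>\<omega>. \<bar>real_cond_exp M (F (Suc k)) (indicator (A T)) \<omega>
          - real_cond_exp M (F k) (indicator (A T)) \<omega>\<bar> \<partial>M)) \<le> (S + 1) / 2"
          using sum_posterior_increments_le[where F = F and \<eta> = \<eta> and n = n, OF F A[of T]] \<eta>(2)[of n] by simp
      qed
      finally show ?thesis by simp
    qed
    have \<delta>: "(\<Sum>k=1..n. \<eta> k * max 0 (\<delta> k)) \<le> S' * G\<^sup>2 / c"
    proof -
      have "(\<Sum>k=1..n. \<eta> k * max 0 (\<delta> k)) = (\<Sum>k=1..n. \<eta> k * (1 - \<theta> k) * (G\<^sup>2 / c))"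
      proof (rule sum.cong[OF refl])
        fix k assume "k \<in> {1..n}"
        then obtain j where "k = Suc j" by (cases k) auto
        then have "\<delta> k \<ge> 0" using \<theta>[of j] c by (simp add: \<delta>_def)
        then show "\<eta> k * max 0 (\<delta> k) = \<eta> k * (1 - \<theta> k) * (G\<^sup>2 / c)" by (simp add: \<delta>_def)
      qed
      also have "\<dots> = (\<Sum>k=1..n. \<eta> k * (1 - \<theta> k)) * (G\<^sup>2 / c)" by (simp only: sum_distrib_right)
      also have "\<dots> \<le> S' * (G\<^sup>2 / c)" using \<eta>(3)[of n] c by (intro mult_right_mono) auto
      finally show ?thesis by simp
    qed
    have "(\<Sum>k=1..n. \<eta> k * e k) = G / c * H * ((\<Sum>k=1..n. \<eta> k * max 0 (\<delta> k)) + C * (\<Sum>k=1..n. \<eta> k * R k))"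
      unfolding e_def sum_distrib_left sum.distrib[symmetric]
      by (rule sum.cong) (auto simp: algebra_simps)
    also have "\<dots> \<le> G / c * H * (S' * G\<^sup>2 / c + C * (card I * ((S + 1) / 2)))"
      using R \<delta> c G(2) H0 by (intro mult_left_mono add_mono) auto
    finally show ?thesis .
  qed
  moreover have "\<beta> (Suc k) * (\<integral>\<omega>. \<phi> k \<omega> * h k \<omega> \<partial>M) + (1 - \<beta>max) / sqrt (G\<^sup>2 + \<epsilon>) * (\<integral>\<omega>. (\<phi> k \<omega>)\<^sup>2 \<partial>M) - e (Suc k)
        \<le> (\<integral>\<omega>. \<phi> k \<omega> * h (Suc k) \<omega> \<partial>M)" for k
  proof -
    have rec: "AE \<omega> in M. sqrt (v (Suc k) \<omega> + \<epsilon>) * h (Suc k) \<omega>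
        = \<beta> (Suc k) * (sqrt (v k \<omega> + \<epsilon>) * h k \<omega>) + (1 - \<beta> (Suc k)) * g (Suc k) \<omega>"
      using good
    proof eventually_elim
      case (elim \<omega>)
      have "sqrt (v k \<omega> + \<epsilon>) * h k \<omega> = m k \<omega>" for k
        using elim mv[of \<omega> k] \<epsilon> by (simp add: h)
      then show ?case using elim m by simp
    qed
    have "AE \<omega> in M. \<bar>sqrt (v (Suc k) \<omega> + \<epsilon>) - sqrt (v k \<omega> + \<epsilon>)\<bar> \<le> max 0 (\<delta> (Suc k))"
      using W\<delta>[of k] by eventually_elim linarith
    from hidden_scale_step[OF F(1) F(1) F(2) A part YF Yb c _ WY _ this hF hb hF hb gM G(1) \<phi> _ \<beta>1 rec]
    have "\<beta> (Suc k) * (\<integral>\<omega>. \<phi> k \<omega> * h k \<omega> \<partial>M) + (1 - \<beta> (Suc k)) / C * (\<integral>\<omega>. (\<phi> k \<omega>)\<^sup>2 \<partial>M) - e (Suc k)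
        \<le> (\<integral>\<omega>. \<phi> k \<omega> * h (Suc k) \<omega> \<partial>M)"
      using \<beta>[of k] unfolding e_def R_def by simp
    moreover have "(1 - \<beta>max) / C * (\<integral>\<omega>. (\<phi> k \<omega>)\<^sup>2 \<partial>M) \<le> (1 - \<beta> (Suc k)) / C * (\<integral>\<omega>. (\<phi> k \<omega>)\<^sup>2 \<partial>M)"
      using \<beta>[of k] c by (intro mult_right_mono divide_right_mono integral_nonneg_AE) auto
    ultimately show ?thesis unfolding C_def by linarith
  qed
  ultimately show ?thesis by blast
qed

section \<open>The filtration generated by the iterates\<close>

text \<open>By monotone convergence the sum of the series has finite expectation, hence is almost
  surely finite.\<close>

lemma (in prob_space) AE_summable_of_expectations:
  fixes Z :: "nat \<Rightarrow> 'a \<Rightarrow> real"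
  assumes int: "\<And>k. integrable M (Z k)" and nonneg: "\<And>k \<omega>. Z k \<omega> \<ge> 0"
    and B: "\<And>n. (\<Sum>k<n. \<integral>\<omega>. Z k \<omega> \<partial>M) \<le> B"
  shows "AE \<omega> in M. summable (\<lambda>k. Z k \<omega>)"
proof -
  have [measurable]: "Z k \<in> borel_measurable M" for k using int by auto
  have "(\<integral>\<^sup>+\<omega>. (\<Sum>k. ennreal (Z k \<omega>)) \<partial>M) = (\<Sum>k. ennreal (\<integral>\<omega>. Z k \<omega> \<partial>M))"
    using int nonneg by (subst nn_integral_suminf) (auto simp: nn_integral_eq_integral)
  also have "\<dots> \<le> ennreal B"
    using B nonneg by (intro suminf_le_const) (auto simp: sum_ennreal intro!: ennreal_leI)
  finally have "(\<integral>\<^sup>+\<omega>. (\<Sum>k. ennreal (Z k \<omega>)) \<partial>M) \<noteq> \<infinity>" by (auto simp: top_unique)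
  then have "AE \<omega> in M. (\<Sum>k. ennreal (Z k \<omega>)) \<noteq> \<infinity>" by (intro nn_integral_PInf_AE) auto
  then show ?thesis by eventually_elim (use nonneg in \<open>auto intro: summable_suminf_not_top\<close>)
qed

lemma sets_history_mono:
  assumes "k \<le> l"
  shows "sets (history M x k) \<subseteq> sets (history M x l)"
proof -
  have "(\<Union>j\<in>{1..k}. {x j -` A \<inter> space M | A. A \<in> sets borel})
      \<subseteq> (\<Union>j\<in>{1..l}. {x j -` A \<inter> space M | A. A \<in> sets borel})"
    using assms by (intro UN_mono) auto
  then show ?thesis
    unfolding history_def by (subst (1 2) sets_measure_of) (blast intro: sigma_sets_mono'[THEN subsetD])+
qed

lemma space_history [simp]: "space (history M x k) = space M"
  unfolding history_def by (rule space_measure_of) auto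

lemma subalgebra_history_Suc: "subalgebra (history M x (Suc k)) (history M x k)"
  by (simp add: subalgebra_def sets_history_mono)

lemma measurable_history:
  assumes "1 \<le> j" "j \<le> k"
  shows "x j \<in> borel_measurable (history M x k)"
proof (rule measurableI)
  fix A :: "'b set" assume "A \<in> sets borel"
  then have "x j -` A \<inter> space M \<in> (\<Union>j\<in>{1..k}. {x j -` A \<inter> space M | A. A \<in> sets borel})"
    using assms by (intro UN_I[of j]) auto
  then show "x j -` A \<inter> space (history M x k) \<in> sets (history M x k)"
    unfolding space_history unfolding history_def by (subst sets_measure_of) (auto intro: sigma_sets.Basic)
qed simp

lemma subalgebra_history:
  assumes "\<And>j. 1 \<le> j \<Longrightarrow> x j \<in> borel_measurable M"
  shows "subalgebra M (history M x k)"
proof -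
  have "sets (history M x k) \<subseteq> sets M"
    unfolding history_def
    by (subst sets_measure_of) (use assms in \<open>auto intro!: sets.sigma_sets_subset\<close>)
  then show ?thesis by (simp add: subalgebra_def)
qed

lemma borel_measurable_vec_componentwise:
  fixes f :: "'a \<Rightarrow> real ^ 'n"
  assumes [measurable]: "\<And>i. (\<lambda>\<omega>. f \<omega> $ i) \<in> borel_measurable M"
  shows "f \<in> borel_measurable M"
proof -
  have "f = (\<lambda>\<omega>. \<Sum>i\<in>UNIV. (f \<omega> $ i) *\<^sub>R axis i 1)"
    using basis_expansion[of "f _"] by (simp add: scalar_mult_eq_scaleR)
  then show ?thesis by (subst \<open>f = _\<close>) measurable
qed

lemma borel_measurable_vec_nth:
  fixes f :: "'a \<Rightarrow> real ^ 'n"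
  assumes "f \<in> borel_measurable M"
  shows "(\<lambda>\<omega>. f \<omega> $ i) \<in> borel_measurable M"
proof -
  have "(\<lambda>y :: real ^ 'n. y $ i) \<in> borel_measurable borel"
    by (intro borel_measurable_continuous_onI continuous_intros)
  then show ?thesis using assms by (rule measurable_compose_rev)
qed

section \<open>The rate\<close>

theorem corollary10:
  fixes M :: "'a measure" and P :: "'s measure"
    and f :: "real ^ 'n \<Rightarrow> real" and \<l> :: "real ^ 'n \<Rightarrow> 's \<Rightarrow> real"
    and \<xi> :: "nat \<Rightarrow> 'a \<Rightarrow> 's"
    and g m v x :: "nat \<Rightarrow> 'a \<Rightarrow> real ^ 'n" and x1 :: "real ^ 'n"
    and \<eta> \<beta> \<theta> :: "nat \<Rightarrow> real" and \<epsilon> \<beta>max G L p q :: real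
  assumes "prob_space M" and "prob_space P"
    and "\<And>y. f differentiable (at y)"
    and "\<And>y. integrable P (\<l> y)" and "\<And>y. f y = (\<integral>s. \<l> y s \<partial>P)"
    and "adam_parameters \<eta> \<epsilon> \<beta> \<beta>max \<theta>"
    and "adam_run M P \<l> \<eta> \<epsilon> \<beta> \<theta> x1 \<xi> g m v x"
    and "\<And>k. k \<ge> 1 \<Longrightarrow>
           AE \<omega> in M. vec_cond_exp M (history M x k) (g k) \<omega> = grad f (x k \<omega>)"
    and "G > 0" and "\<And>k. k \<ge> 1 \<Longrightarrow> AE \<omega> in M. norm (g k \<omega>) \<le> G"
    and "bdd_below (range f)"
    and "L > 0" and "\<And>y z. norm (grad f y - grad f z) \<le> L * norm (y - z)"
    and "1 / 2 < q" and "q < 1" and "p > 1 - q"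
    and "\<And>k. k \<ge> 1 \<Longrightarrow> \<eta> k = 1 / real k powr q"
    and "\<And>k. k \<ge> 1 \<Longrightarrow> \<theta> k = 1 - 1 / real k powr p"
  shows "AE \<omega> in M.
    (\<lambda>K. MIN k\<in>{1..K}. (norm (grad f (x k \<omega>)))\<^sup>2) \<in> o(\<lambda>K. 1 / real K powr (1 - q))"
proof -
  interpret prob_space M by fact
  note params = assms(6)[unfolded adam_parameters_def]
  note run = assms(7)[unfolded adam_run_def]
  note \<eta>eq = assms(17) and \<theta>eq = assms(18)
  note diff = assms(3) and Lip = assms(13)
  have \<epsilon>: "\<epsilon> > 0" and \<beta>max: "\<beta>max < 1" and G0: "G > 0" and L0: "L > 0" using params assms by auto
  have \<beta>: "0 \<le> \<beta> (Suc k) \<and> \<beta> (Suc k) \<le> \<beta>max" and \<theta>: "0 \<le> \<theta> (Suc k) \<and> \<theta> (Suc k) < 1" for k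
    using params by auto
  have gM: "g (Suc k) \<in> borel_measurable M" for k using run by simp
  have init: "m 0 \<omega> = 0" "v 0 \<omega> = 0" "x 1 \<omega> = x1" if "\<omega> \<in> space M" for \<omega>
    using run that by auto
  have upd: "m (Suc k) \<omega> $ i = \<beta> (Suc k) * m k \<omega> $ i + (1 - \<beta> (Suc k)) * g (Suc k) \<omega> $ i"
    "v (Suc k) \<omega> $ i = \<theta> (Suc k) * v k \<omega> $ i + (1 - \<theta> (Suc k)) * (g (Suc k) \<omega> $ i)\<^sup>2"
    "x (Suc (Suc k)) \<omega> $ i = x (Suc k) \<omega> $ i - \<eta> (Suc k) * (m (Suc k) \<omega> $ i / sqrt (v (Suc k) \<omega> $ i + \<epsilon>))"
    if "\<omega> \<in> space M" for \<omega> k i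
    using run that by (metis One_nat_def Suc_eq_plus1 diff_Suc_1 le_add2)+

  \<comment> \<open>Measurability and the filtration of the iterates\<close>
  have "(\<lambda>\<omega>. m k \<omega> $ i) \<in> borel_measurable M \<and> (\<lambda>\<omega>. v k \<omega> $ i) \<in> borel_measurable M
      \<and> (\<lambda>\<omega>. x (Suc k) \<omega> $ i) \<in> borel_measurable M" for k i
  proof (induction k)
    case 0
    show ?case using init by (auto cong: measurable_cong)
  next
    case (Suc k)
    note [measurable] = Suc[THEN conjunct1] Suc[THEN conjunct2, THEN conjunct1]
      Suc[THEN conjunct2, THEN conjunct2] borel_measurable_vec_nth[OF gM]
    have 1[measurable]: "(\<lambda>\<omega>. m (Suc k) \<omega> $ i) \<in> borel_measurable M"
      "(\<lambda>\<omega>. v (Suc k) \<omega> $ i) \<in> borel_measurable M"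
      using upd by (simp_all cong: measurable_cong)
    have "(\<lambda>\<omega>. x (Suc (Suc k)) \<omega> $ i) \<in> borel_measurable M"
      using upd(3)[of _ k i] by (simp cong: measurable_cong)
    with 1 show ?case by simp
  qed
  then have xM: "x k \<in> borel_measurable M" if "1 \<le> k" for k
    using that by (cases k) (auto intro: borel_measurable_vec_componentwise)
  have F: "subalgebra M (history M x k)" "subalgebra (history M x (Suc k)) (history M x k)" for k
    by (rule subalgebra_history[OF xM], assumption) (rule subalgebra_history_Suc)

  \<comment> \<open>The step is written through the iterates and not through the moments, which
    makes it measurable for their history at time \<open>Suc k\<close>. The value at 0 agrees with
    \<open>m 0 = 0\<close>.\<close>
  define h where "h k \<omega> = (if k = 0 then 0 else (1 / \<eta> k) *\<^sub>R (x k \<omega> - x (Suc k) \<omega>))" for k \<omega>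
  have \<eta>pos: "\<eta> (Suc k) > 0" for k using params by auto
  have h_eq: "h k \<omega> $ i = m k \<omega> $ i / sqrt (v k \<omega> $ i + \<epsilon>)" if "\<omega> \<in> space M" for k \<omega> i
  proof (cases k)
    case 0
    then show ?thesis using init[OF that] by (simp add: h_def)
  next
    case (Suc j)
    then show ?thesis using upd(3)[OF that, of j i] \<eta>pos[of j] by (simp add: h_def)
  qed
  have hF: "h k \<in> borel_measurable (history M x (Suc k))" for k
  proof (cases k)
    case 0
    then show ?thesis by (simp add: h_def[abs_def])
  next
    case (Suc j)
    have [measurable]: "x k \<in> borel_measurable (history M x (Suc k))"
      "x (Suc k) \<in> borel_measurable (history M x (Suc k))"
      using Suc by (auto intro!: measurable_history)
    show ?thesis unfolding h_def by measurable
  qed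
  have hM[measurable]: "h k \<in> borel_measurable M" for k by (rule measurable_from_subalg[OF F(1) hF])

  have step: "x (Suc (Suc k)) \<omega> - x (Suc k) \<omega> = - \<eta> (Suc k) *\<^sub>R h (Suc k) \<omega>" for k \<omega>
    using \<eta>pos[of k] by (simp add: h_def)

  have gradM: "grad f \<in> borel_measurable borel"
  proof (rule borel_measurable_continuous_onI)
    have "L-lipschitz_on UNIV (grad f)"
      using Lip L0 by (intro lipschitz_onI) (auto simp: dist_norm)
    then show "continuous_on UNIV (grad f)" by (rule lipschitz_on_continuous_on)
  qed
  \<comment> \<open>The index is shifted: this is the gradient at \<open>x (Suc k)\<close>, where
    \<open>g (Suc k)\<close> is sampled, and it is known together with \<open>h k\<close>.\<close>
  define \<phi> where "\<phi> k \<omega> = grad f (x (Suc k) \<omega>)" for k \<omega>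
  have \<phi>F: "\<phi> k \<in> borel_measurable (history M x (Suc k))" for k
    unfolding \<phi>_def using measurable_history[of "Suc k" "Suc k" x M] gradM by (auto intro: measurable_compose)
  have [measurable]: "\<phi> k \<in> borel_measurable M" for k by (rule measurable_from_subalg[OF F(1) \<phi>F])
  have gb: "AE \<omega> in M. \<bar>g (Suc k) \<omega> $ i\<bar> \<le> G" for k i
    using assms(10)[of "Suc k", simplified] by eventually_elim (rule norm_bound_component_le_cart)
  have \<phi>ce: "AE \<omega> in M. real_cond_exp M (history M x (Suc k)) (\<lambda>\<omega>. g (Suc k) \<omega> $ i) \<omega> = \<phi> k \<omega> $ i" for k i
    using assms(8)[of "Suc k", simplified] by eventually_elim (simp add: vec_cond_exp_def \<phi>_def vec_eq_iff)
  have \<phi>b: "AE \<omega> in M. \<bar>\<phi> k \<omega> $ i\<bar> \<le> G" for k i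
    using real_cond_exp_abs_le[OF F(1)[of "Suc k"] borel_measurable_vec_nth[OF gM] gb[of k i]] \<phi>ce[of k i]
    by eventually_elim simp

  \<comment> \<open>Almost sure bounds on steps and gradients\<close>
  define H where "H = G / sqrt \<epsilon>"
  have hb: "AE \<omega> in M. \<forall>k i. \<bar>h k \<omega> $ i\<bar> \<le> H"
  proof -
    have "AE \<omega> in M. \<omega> \<in> space M \<and> (\<forall>k i. \<bar>g (Suc k) \<omega> $ i\<bar> \<le> G)"
      using gb AE_space by (simp add: AE_all_countable)
    then show ?thesis
    proof eventually_elim
      case (elim \<omega>)
      show ?case
      proof (intro allI)
        fix k i
        have "\<bar>m k \<omega> $ i\<bar> \<le> G \<and> 0 \<le> v k \<omega> $ i \<and> v k \<omega> $ i \<le> G\<^sup>2"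
        proof (rule adam_moment_bounds[where \<beta> = \<beta> and \<theta> = \<theta> and g = "\<lambda>k. g k \<omega> $ i"])
          show "0 \<le> \<beta> (Suc k) \<and> \<beta> (Suc k) \<le> 1" for k using \<beta>[of k] \<beta>max by auto
          show "0 \<le> \<theta> (Suc k) \<and> \<theta> (Suc k) \<le> 1" for k using \<theta>[of k] by auto
        qed (use elim upd init in auto)
        then show "\<bar>h k \<omega> $ i\<bar> \<le> H"
          using elim \<epsilon> G0 unfolding h_eq[OF elim[THEN conjunct1]] abs_divide H_def
          by (intro frac_le) auto
      qed
    qed
  qed
  define Hn where "Hn = CARD('n) * H"
  have hn: "AE \<omega> in M. \<forall>k. norm (h k \<omega>) \<le> Hn"
    using hb
  proof eventually_elim
    case (elim \<omega>)
    show ?case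
    proof
      fix k
      have "norm (h k \<omega>) \<le> (\<Sum>i\<in>UNIV. \<bar>h k \<omega> $ i\<bar>)" by (rule norm_le_l1_cart)
      also have "\<dots> \<le> (\<Sum>i\<in>(UNIV :: 'n set). H)" using elim by (intro sum_mono) auto
      finally show "norm (h k \<omega>) \<le> Hn" by (simp add: Hn_def)
    qed
  qed
  have \<phi>n: "AE \<omega> in M. norm (\<phi> k \<omega>) \<le> CARD('n) * G" for k
  proof -
    have "AE \<omega> in M. \<forall>i. \<bar>\<phi> k \<omega> $ i\<bar> \<le> G" using \<phi>b by (simp add: AE_all_countable)
    then show ?thesis
    proof eventually_elim
      case (elim \<omega>)
      have "norm (\<phi> k \<omega>) \<le> (\<Sum>i\<in>UNIV. \<bar>\<phi> k \<omega> $ i\<bar>)" by (rule norm_le_l1_cart)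
      also have "\<dots> \<le> (\<Sum>i\<in>(UNIV :: 'n set). G)" using elim by (intro sum_mono) auto
      finally show ?case by simp
    qed
  qed
  have Hn0: "Hn \<ge> 0" using G0 \<epsilon> by (simp add: Hn_def H_def)

  \<comment> \<open>\<open>\<eta> 0\<close> is unconstrained, whereas \<open>\<eta>' 0 = 1 / 0 = 0\<close>.\<close>
  define \<eta>' where "\<eta>' k = 1 / real k powr q" for k
  have \<eta>': "\<eta> (Suc k) = \<eta>' (Suc k)" for k using \<eta>eq by (simp add: \<eta>'_def)
  have \<eta>'0: "\<eta>' k \<ge> 0" "\<eta>' 0 = 0" for k by (auto simp: \<eta>'_def)
  have \<eta>'dec: "\<eta>' (Suc k) \<le> \<eta>' k" if "k \<ge> 1" for k
    using that assms(14) unfolding \<eta>'_def by (intro divide_left_mono powr_mono2) auto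
  \<comment> \<open>The squares are summable because \<open>2 * q > 1\<close>; below,
    \<open>\<eta>' k * (1 - \<theta> k)\<close> equals \<open>k powr - (p + q)\<close>, summable
    because \<open>p + q > 1\<close>.\<close>
  define S where "S = (\<Sum>k. (\<eta>' k)\<^sup>2)"
  have "(\<eta>' k)\<^sup>2 = real k powr (- (2 * q))" for k
  proof -
    have "(real k powr q)\<^sup>2 = real k powr (2 * q)"
      by (simp only: power2_eq_square powr_add[symmetric] mult_2)
    then show ?thesis by (simp add: \<eta>'_def powr_minus power_divide field_simps)
  qed
  then have sS: "summable (\<lambda>k. (\<eta>' k)\<^sup>2)"
    using assms(14) summable_real_powr_iff[of "- (2 * q)"] by simp
  have S: "(\<Sum>k\<in>A. (\<eta>' k)\<^sup>2) \<le> S" if "finite A" for A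
    unfolding S_def using sS that by (intro sum_le_suminf) auto
  define S' where "S' = (\<Sum>k. real k powr - (p + q))"
  have sS': "summable (\<lambda>k. real k powr - (p + q))"
    using assms(16) summable_real_powr_iff[of "- (p + q)"] by simp
  have S': "(\<Sum>k=1..n. \<eta>' k * (1 - \<theta> k)) \<le> S'" for n
  proof -
    have "(\<Sum>k=1..n. \<eta>' k * (1 - \<theta> k)) = (\<Sum>k=1..n. real k powr - (p + q))"
    proof (rule sum.cong[OF refl])
      fix k assume k: "k \<in> {1..n}"
      have "real k powr - (p + q) = inverse (real k powr p * real k powr q)"
        by (simp only: powr_minus powr_add)
      then show "\<eta>' k * (1 - \<theta> k) = real k powr - (p + q)" using k by (simp add: \<eta>'_def \<theta>eq field_simps)
    qed
    also have "\<dots> \<le> S'" unfolding S'_def using sS' by (intro sum_le_suminf) auto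
    finally show ?thesis .
  qed
  have \<theta>lim: "\<theta> \<longlonglongrightarrow> 1"
  proof -
    have "p > 0" using assms(15,16) by simp
    have "(\<lambda>k. 1 - real k powr - p) \<longlonglongrightarrow> 1 - 0"
      using \<open>p > 0\<close> by (intro tendsto_intros tendsto_neg_powr filterlim_real_sequentially) auto
    moreover have "\<forall>\<^sub>F k in sequentially. 1 - real k powr - p = \<theta> k"
      using eventually_ge_at_top[of 1] by eventually_elim (simp add: \<theta>eq powr_minus field_simps)
    ultimately show ?thesis by (simp add: tendsto_cong)
  qed

  \<comment> \<open>The lower bound in each coordinate\<close>
  define c where "c = (1 - \<beta>max) / sqrt (G\<^sup>2 + \<epsilon>)"
  have c0: "c > 0" using \<beta>max \<epsilon> by (simp add: c_def add_nonneg_pos)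
  have "\<exists>e E. (\<forall>k. e k \<ge> 0) \<and> (\<forall>n. (\<Sum>k=1..n. \<eta>' k * e k) \<le> E) \<and>
    (\<forall>k. \<beta> (Suc k) * (\<integral>\<omega>. \<phi> k \<omega> $ i * h k \<omega> $ i \<partial>M) + c * (\<integral>\<omega>. (\<phi> k \<omega> $ i)\<^sup>2 \<partial>M) - e (Suc k)
        \<le> (\<integral>\<omega>. \<phi> k \<omega> $ i * h (Suc k) \<omega> $ i \<partial>M))" for i
    unfolding c_def
  proof (rule adam_coordinate_step[where F = "history M x" and g = "\<lambda>k \<omega>. g k \<omega> $ i"
        and m = "\<lambda>k \<omega>. m k \<omega> $ i" and v = "\<lambda>k \<omega>. v k \<omega> $ i" and h = "\<lambda>k \<omega>. h k \<omega> $ i"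
        and \<phi> = "\<lambda>k \<omega>. \<phi> k \<omega> $ i" and \<theta> = \<theta>])
    show "(\<Sum>k=1..n. (\<eta>' k)\<^sup>2) \<le> S" for n by (rule S) simp
    show "(\<lambda>\<omega>. h k \<omega> $ i) \<in> borel_measurable (history M x (Suc k))"
      "(\<lambda>\<omega>. \<phi> k \<omega> $ i) \<in> borel_measurable (history M x (Suc k))" for k
      by (rule borel_measurable_vec_nth[OF hF] borel_measurable_vec_nth[OF \<phi>F])+
    show "(\<lambda>\<omega>. g (Suc k) \<omega> $ i) \<in> borel_measurable M" for k
      by (rule borel_measurable_vec_nth[OF gM])
    show "m 0 \<omega> $ i = 0 \<and> v 0 \<omega> $ i = 0" if "\<omega> \<in> space M" for \<omega>
      using init[OF that] by simp
  qed (fact F upd h_eq \<epsilon> \<beta> \<beta>max \<theta> \<theta>lim gb G0 \<phi>ce \<eta>'0 S')+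
  \<comment> \<open>Error sequence and bound are packed into one pair, so that a single choice over
    the coordinates yields both.\<close>
  then have "\<forall>i. \<exists>eE. (\<forall>k. fst eE k \<ge> 0) \<and> (\<forall>n. (\<Sum>k=1..n. \<eta>' k * fst eE k) \<le> snd eE) \<and>
    (\<forall>k. \<beta> (Suc k) * (\<integral>\<omega>. \<phi> k \<omega> $ i * h k \<omega> $ i \<partial>M) + c * (\<integral>\<omega>. (\<phi> k \<omega> $ i)\<^sup>2 \<partial>M) - fst eE (Suc k)
        \<le> (\<integral>\<omega>. \<phi> k \<omega> $ i * h (Suc k) \<omega> $ i \<partial>M))"
    by simp
  then obtain eE where eE: "\<forall>i. (\<forall>k. fst (eE i) k \<ge> 0) \<and> (\<forall>n. (\<Sum>k=1..n. \<eta>' k * fst (eE i) k) \<le> snd (eE i)) \<and>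
    (\<forall>k. \<beta> (Suc k) * (\<integral>\<omega>. \<phi> k \<omega> $ i * h k \<omega> $ i \<partial>M) + c * (\<integral>\<omega>. (\<phi> k \<omega> $ i)\<^sup>2 \<partial>M) - fst (eE i) (Suc k)
        \<le> (\<integral>\<omega>. \<phi> k \<omega> $ i * h (Suc k) \<omega> $ i \<partial>M))"
    by (rule choice[THEN exE])
  define e0 E0 where "e0 i = fst (eE i)" and "E0 i = snd (eE i)" for i
  have e0: "e0 i k \<ge> 0" "(\<Sum>k=1..n. \<eta>' k * e0 i k) \<le> E0 i"
    and rec: "\<beta> (Suc k) * (\<integral>\<omega>. \<phi> k \<omega> $ i * h k \<omega> $ i \<partial>M) + c * (\<integral>\<omega>. (\<phi> k \<omega> $ i)\<^sup>2 \<partial>M) - e0 i (Suc k)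
        \<le> (\<integral>\<omega>. \<phi> k \<omega> $ i * h (Suc k) \<omega> $ i \<partial>M)" for i k n
    using eE by (simp_all add: e0_def E0_def)

  \<comment> \<open>Summation over the coordinates\<close>
  have int_ij: "integrable M (\<lambda>\<omega>. \<phi> k \<omega> $ i * h j \<omega> $ i)" "integrable M (\<lambda>\<omega>. (\<phi> k \<omega> $ i)\<^sup>2)" for k j i
  proof -
    note [measurable] = borel_measurable_vec_nth[OF hM, of j i]
      borel_measurable_vec_nth[of "\<phi> k" M i]
    show "integrable M (\<lambda>\<omega>. \<phi> k \<omega> $ i * h j \<omega> $ i)"
    proof (rule integrable_const_bound[of _ "G * H"])
      show "AE \<omega> in M. norm (\<phi> k \<omega> $ i * h j \<omega> $ i) \<le> G * H"
        using \<phi>b[of k i] hb by eventually_elim (use G0 in \<open>auto simp: abs_mult intro!: mult_mono\<close>)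
    qed measurable
    show "integrable M (\<lambda>\<omega>. (\<phi> k \<omega> $ i)\<^sup>2)"
    proof (rule integrable_const_bound[of _ "G\<^sup>2"])
      show "AE \<omega> in M. norm ((\<phi> k \<omega> $ i)\<^sup>2) \<le> G\<^sup>2"
        using \<phi>b[of k i] by eventually_elim (use G0 in \<open>auto simp: abs_le_square_iff[symmetric]\<close>)
    qed measurable
  qed
  define ip where "ip k j = (\<integral>\<omega>. inner (\<phi> k \<omega>) (h j \<omega>) \<partial>M)" for k j
  have int_ip: "integrable M (\<lambda>\<omega>. inner (\<phi> k \<omega>) (h j \<omega>))" for k j
    unfolding inner_vec_def using int_ij(1) by simp
  have ip_sum: "ip k j = (\<Sum>i\<in>UNIV. \<integral>\<omega>. \<phi> k \<omega> $ i * h j \<omega> $ i \<partial>M)" for k j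
    unfolding ip_def inner_vec_def using int_ij(1) by (simp add: Bochner_Integration.integral_sum)
  define nb where "nb k = (\<integral>\<omega>. (norm (\<phi> k \<omega>))\<^sup>2 \<partial>M)" for k
  have norm2: "(norm (\<phi> k \<omega>))\<^sup>2 = (\<Sum>i\<in>UNIV. (\<phi> k \<omega> $ i)\<^sup>2)" for k \<omega>
    unfolding power2_norm_eq_inner inner_vec_def by (simp add: power2_eq_square)
  have int_nb: "integrable M (\<lambda>\<omega>. (norm (\<phi> k \<omega>))\<^sup>2)" for k
    unfolding norm2 using int_ij(2) by simp
  have nb_sum: "nb k = (\<Sum>i\<in>UNIV. \<integral>\<omega>. (\<phi> k \<omega> $ i)\<^sup>2 \<partial>M)" for k
    unfolding nb_def norm2 using int_ij(2) by (simp add: Bochner_Integration.integral_sum)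

  \<comment> \<open>For \<open>k \<ge> 1\<close> these are the expectations of
    \<open>inner (grad f (x k)) (h k)\<close> and of the squared gradient norm at
    \<open>x k\<close>. The second part of \<open>e k\<close> is the cost computed in
    \<open>shift\<close> for the previous step.\<close>
  define a where "a k = (case k of 0 \<Rightarrow> 0 | Suc j \<Rightarrow> ip j (Suc j))" for k
  define b where "b k = nb (k - 1)" for k
  define e where "e k = (\<Sum>i\<in>UNIV. e0 i k) + L * Hn\<^sup>2 * \<eta>' (k - 1)" for k
  \<comment> \<open>The coordinate bound tests the old step against the new gradient, whereas
    \<open>a k\<close> pairs \<open>h k\<close> with the gradient at \<open>x k\<close>. Between the
    two points the gradient changes by at most \<open>L * \<eta>' k * Hn\<close>, and pairing with
    \<open>h k\<close> brings in another \<open>Hn\<close>.\<close>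
  have shift: "ip k k \<ge> a k - L * Hn\<^sup>2 * \<eta>' k" for k
  proof (cases k)
    case 0
    then show ?thesis by (simp add: a_def ip_def h_def \<eta>'0)
  next
    case (Suc j)
    have "ip j k - ip k k = (\<integral>\<omega>. inner (\<phi> j \<omega> - \<phi> k \<omega>) (h k \<omega>) \<partial>M)"
      unfolding ip_def inner_diff_left using int_ip by simp
    also have "\<dots> \<le> (\<integral>\<omega>. L * Hn\<^sup>2 * \<eta>' k \<partial>M)"
    proof (rule integral_mono_AE)
      show "integrable M (\<lambda>\<omega>. inner (\<phi> j \<omega> - \<phi> k \<omega>) (h k \<omega>))"
        unfolding inner_diff_left using int_ip by simp
      show "AE \<omega> in M. inner (\<phi> j \<omega> - \<phi> k \<omega>) (h k \<omega>) \<le> L * Hn\<^sup>2 * \<eta>' k"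
        using hn
      proof eventually_elim
        case (elim \<omega>)
        have "norm (x (Suc j) \<omega> - x (Suc k) \<omega>) = \<eta>' k * norm (h k \<omega>)"
          using step[of j \<omega>] \<eta>pos[of j] \<eta>'[of j] Suc by (subst norm_minus_commute) simp
        then have "norm (\<phi> j \<omega> - \<phi> k \<omega>) \<le> L * (\<eta>' k * norm (h k \<omega>))"
          using Lip[of "x (Suc j) \<omega>" "x (Suc k) \<omega>"] by (simp add: \<phi>_def)
        also have "\<dots> \<le> L * (\<eta>' k * Hn)"
          using elim L0 \<eta>'0 by (intro mult_left_mono) auto
        finally have 1: "norm (\<phi> j \<omega> - \<phi> k \<omega>) \<le> L * (\<eta>' k * Hn)" .
        have "inner (\<phi> j \<omega> - \<phi> k \<omega>) (h k \<omega>) \<le> norm (\<phi> j \<omega> - \<phi> k \<omega>) * norm (h k \<omega>)"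
          by (rule norm_cauchy_schwarz)
        also have "\<dots> \<le> L * (\<eta>' k * Hn) * Hn"
          using 1 elim L0 \<eta>'0 Hn0 by (intro mult_mono) auto
        finally show ?case by (simp add: power2_eq_square mult_ac)
      qed
    qed simp
    finally show ?thesis using Suc by (simp add: a_def prob_space)
  qed
  have arec: "a k \<ge> \<beta> k * a (k - 1) + c * b k - e k" if "k \<ge> 1" for k
  proof -
    obtain j where k: "k = Suc j" using \<open>k \<ge> 1\<close> by (auto simp: Suc_le_eq dest: gr0_implies_Suc)
    have "\<beta> k * ip j j + c * nb j - (\<Sum>i\<in>UNIV. e0 i k)
      = (\<Sum>i\<in>UNIV. \<beta> k * (\<integral>\<omega>. \<phi> j \<omega> $ i * h j \<omega> $ i \<partial>M) + c * (\<integral>\<omega>. (\<phi> j \<omega> $ i)\<^sup>2 \<partial>M) - e0 i k)"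
      by (simp add: ip_sum nb_sum sum_distrib_left sum.distrib sum_subtractf)
    also have "\<dots> \<le> ip j k" unfolding ip_sum k by (intro sum_mono rec)
    finally have 1: "\<beta> k * ip j j + c * nb j - (\<Sum>i\<in>UNIV. e0 i k) \<le> a k" by (simp add: a_def k)
    have "\<beta> k * (a j - L * Hn\<^sup>2 * \<eta>' j) \<le> \<beta> k * ip j j"
      using shift[of j] \<beta>[of j] by (intro mult_left_mono) (auto simp: k)
    moreover have "\<beta> k * (L * Hn\<^sup>2 * \<eta>' j) \<le> 1 * (L * Hn\<^sup>2 * \<eta>' j)"
      using \<beta>[of j] \<beta>max L0 \<eta>'0 by (intro mult_right_mono) (auto simp: k)
    ultimately show ?thesis using 1 by (simp add: b_def e_def k right_diff_distrib)
  qed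
  have e_pos: "e k \<ge> 0" for k
    unfolding e_def using e0 L0 \<eta>'0 by (intro add_nonneg_nonneg sum_nonneg mult_nonneg_nonneg) auto
  have e_sum: "(\<Sum>k=1..n. \<eta>' k * e k) \<le> (\<Sum>i\<in>UNIV. E0 i) + L * Hn\<^sup>2 * S" for n
  proof -
    \<comment> \<open>Monotonicity of \<eta>' bounds the product by a square; for
      \<open>k = 1\<close> both sides vanish because \<open>\<eta>' 0 = 0\<close>.\<close>
    have "(\<Sum>k=1..n. \<eta>' k * \<eta>' (k - 1)) \<le> (\<Sum>k=1..n. (\<eta>' (k - 1))\<^sup>2)"
    proof (rule sum_mono)
      fix k assume "k \<in> {1..n}"
      then obtain j where k: "k = Suc j" by (cases k) auto
      show "\<eta>' k * \<eta>' (k - 1) \<le> (\<eta>' (k - 1))\<^sup>2"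
        using \<eta>'dec[of j] \<eta>'0 by (cases j) (auto simp: k power2_eq_square intro: mult_right_mono)
    qed
    also have "\<dots> = (\<Sum>k<n. (\<eta>' k)\<^sup>2)"
      by (rule sum.reindex_bij_witness[of _ Suc "\<lambda>k. k - 1"]) auto
    also have "\<dots> \<le> S" by (rule S) simp
    finally have 1: "(\<Sum>k=1..n. \<eta>' k * \<eta>' (k - 1)) \<le> S" .
    have "(\<Sum>k=1..n. \<eta>' k * e k) = (\<Sum>k=1..n. \<Sum>i\<in>UNIV. \<eta>' k * e0 i k) + L * Hn\<^sup>2 * (\<Sum>k=1..n. \<eta>' k * \<eta>' (k - 1))"
      unfolding e_def distrib_left sum.distrib sum_distrib_left by (simp add: mult_ac)
    also have "(\<Sum>k=1..n. \<Sum>i\<in>UNIV. \<eta>' k * e0 i k) = (\<Sum>i\<in>UNIV. \<Sum>k=1..n. \<eta>' k * e0 i k)"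
      by (rule sum.swap)
    also have "\<dots> + L * Hn\<^sup>2 * (\<Sum>k=1..n. \<eta>' k * \<eta>' (k - 1)) \<le> (\<Sum>i\<in>UNIV. E0 i) + L * Hn\<^sup>2 * S"
      using e0(2) 1 L0 by (intro add_mono sum_mono mult_left_mono) auto
    finally show ?thesis .
  qed

  \<comment> \<open>Descent and the upper bound\<close>
  obtain f0 where f0: "\<And>y. f0 \<le> f y" using assms(11) by (auto simp: bdd_below_def)
  have a_sum: "(\<Sum>k=1..n. \<eta>' k * a k) \<le> f x1 - f0 + L * Hn\<^sup>2 * S" for n
  proof -
    have "(\<Sum>k=1..n. \<eta>' k * a k) = (\<Sum>k<n. \<eta>' (Suc k) * ip k (Suc k))"
      by (rule sum.reindex_bij_witness[of _ Suc "\<lambda>k. k - 1"]) (auto simp: a_def split: nat.split)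
    also have "\<dots> = (\<integral>\<omega>. (\<Sum>k<n. \<eta>' (Suc k) * inner (\<phi> k \<omega>) (h (Suc k) \<omega>)) \<partial>M)"
      unfolding ip_def using int_ip by (simp add: Bochner_Integration.integral_sum)
    also have "\<dots> \<le> (\<integral>\<omega>. f x1 - f0 + L * Hn\<^sup>2 * S \<partial>M)"
    proof (rule integral_mono_AE)
      show "integrable M (\<lambda>\<omega>. \<Sum>k<n. \<eta>' (Suc k) * inner (\<phi> k \<omega>) (h (Suc k) \<omega>))" using int_ip by simp
      show "AE \<omega> in M. (\<Sum>k<n. \<eta>' (Suc k) * inner (\<phi> k \<omega>) (h (Suc k) \<omega>)) \<le> f x1 - f0 + L * Hn\<^sup>2 * S"
        using hn AE_space
      proof eventually_elim
        case (elim \<omega>)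
        \<comment> \<open>The descent inequality telescopes along almost every path, its quadratic
          terms being controlled by \<open>Hn\<close> and the summable squares of the step
          sizes.\<close>
        have "f (x (Suc n) \<omega>) \<le> f x1 - (\<Sum>k<n. \<eta>' (Suc k) * inner (\<phi> k \<omega>) (h (Suc k) \<omega>)) + L * Hn\<^sup>2 * (\<Sum>k<n. (\<eta>' (Suc k))\<^sup>2)"
        proof (induction n)
          case 0
          show ?case using init[OF elim(2)] by simp
        next
          case (Suc n)
          have "f (x (Suc (Suc n)) \<omega>) \<le> f (x (Suc n) \<omega>)
            + inner (x (Suc (Suc n)) \<omega> - x (Suc n) \<omega>) (grad f (x (Suc n) \<omega>)) + L * (norm (x (Suc (Suc n)) \<omega> - x (Suc n) \<omega>))\<^sup>2"
            by (rule descent_ineq[OF diff Lip])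
          also have "inner (x (Suc (Suc n)) \<omega> - x (Suc n) \<omega>) (grad f (x (Suc n) \<omega>)) = - (\<eta>' (Suc n) * inner (\<phi> n \<omega>) (h (Suc n) \<omega>))"
            unfolding step by (simp add: \<eta>' \<phi>_def inner_commute)
          also have "(norm (x (Suc (Suc n)) \<omega> - x (Suc n) \<omega>))\<^sup>2 = (\<eta>' (Suc n))\<^sup>2 * (norm (h (Suc n) \<omega>))\<^sup>2"
            unfolding step by (simp add: \<eta>' power_mult_distrib)
          also have "L * ((\<eta>' (Suc n))\<^sup>2 * (norm (h (Suc n) \<omega>))\<^sup>2) \<le> L * ((\<eta>' (Suc n))\<^sup>2 * Hn\<^sup>2)"
            using elim L0 by (intro mult_left_mono power_mono) auto
          finally show ?case using Suc by (simp add: algebra_simps)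
        qed
        moreover have "L * Hn\<^sup>2 * (\<Sum>k<n. (\<eta>' (Suc k))\<^sup>2) \<le> L * Hn\<^sup>2 * S"
        proof -
          have "(\<Sum>k<n. (\<eta>' (Suc k))\<^sup>2) = (\<Sum>k\<in>Suc ` {..<n}. (\<eta>' k)\<^sup>2)" by (simp add: sum.reindex)
          also have "\<dots> \<le> S" by (rule S) simp
          finally show ?thesis using L0 by (intro mult_left_mono) auto
        qed
        ultimately show ?case using f0[of "x (Suc n) \<omega>"] by linarith
      qed
    qed simp
    finally show ?thesis by (simp add: prob_space)
  qed
  have "\<exists>B. \<forall>K. (\<Sum>k=1..K. \<eta>' k * b k) \<le> B"
  proof (rule momentum_sum_bound[OF arec _ c0 _ _ \<beta>max _ \<eta>'dec _ e_pos e_sum a_sum])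
    show "\<beta> k \<ge> 0" "\<beta> k \<le> \<beta>max" "\<eta>' k > 0" if "k \<ge> 1" for k
      using \<beta>[of "k - 1"] that by (auto simp: \<eta>'_def)
    show "b k \<ge> 0" for k by (simp add: b_def nb_def)
  qed (simp_all add: a_def)
  then obtain B where B: "\<And>K. (\<Sum>k=1..K. \<eta>' k * b k) \<le> B" by blast

  \<comment> \<open>From bounded expectations to the almost sure rate\<close>
  have "AE \<omega> in M. summable (\<lambda>k. \<eta>' (Suc k) * (norm (\<phi> k \<omega>))\<^sup>2)"
  proof (rule AE_summable_of_expectations)
    show "(\<Sum>k<n. \<integral>\<omega>. \<eta>' (Suc k) * (norm (\<phi> k \<omega>))\<^sup>2 \<partial>M) \<le> B" for n
    proof -
      have "(\<Sum>k<n. \<integral>\<omega>. \<eta>' (Suc k) * (norm (\<phi> k \<omega>))\<^sup>2 \<partial>M) = (\<Sum>k=1..n. \<eta>' k * b k)"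
        by (rule sum.reindex_bij_witness[of _ "\<lambda>k. k - 1" Suc]) (auto simp: b_def nb_def)
      then show ?thesis using B[of n] by simp
    qed
  qed (use int_nb \<eta>'0 in auto)
  then show ?thesis
  proof eventually_elim
    case (elim \<omega>)
    \<comment> \<open>Undoes the index shift in \<phi>; the extra term at 0 does not affect
      summability.\<close>
    have "summable (\<lambda>k. (norm (grad f (x k \<omega>)))\<^sup>2 / real k powr q)"
      using elim by (subst summable_Suc_iff[symmetric]) (simp add: \<eta>'_def \<phi>_def)
    then show ?case using assms(14) by (intro Min_smallo_of_weighted_summable) auto
  qed
qed

end
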